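(* Let $M$ be a smooth manifold. The classical Courant algebroid structure on $\mathrm{T}M\oplus \mathrm{T}^*M$, with product $(X+\xi)\circ(Y+\eta)=[X,Y]+(\mathcal{L}_X\eta-i_Y d\xi)$, is irreducible. That is, the maps $\lambda I$, $\lambda\in\mathbb{R}$, are the only vector bundle morphisms $\Delta:\mathrm{T}M\oplus \mathrm{T}^*M\to \mathrm{T}M\oplus \mathrm{T}^*M$ over $\mathrm{id}_M$ such that $u\circ\Delta v=\Delta(u\circ v)$ and $\Delta(v\circ v)=(\Delta v)\circ v$ for all sections $u,v$ of $\mathrm{T}M\oplus \mathrm{T}^*M$.
   Context: Sections of $\mathrm{T}M\oplus \mathrm{T}^*M$ are written $X+\xi$ with $X$ a smooth vector field and $\xi$ a smooth 1-form; $[X,Y]$ is the Lie bracket of vector fields, $\mathcal{L}_X$ the Lie derivative, $i_Y$ the contraction, $d$ the de Rham differential. A Courant algebroid is a vector bundle $A\to M$ with (i) an $\mathbb{R}$-bilinear product $\circ$ on $\mathrm{Sec}(A)$ that is Leibniz, i.e. $(X\circ Y)\circ Z=X\circ(Y\circ Z)-Y\circ(X\circ Z)$; (ii) a vector bundle map $\rho:A\to \mathrm{T}M$ over the identity; (iii) a nondegenerate symmetric bilinear form $\langle\cdot,\cdot\rangle$ on $A$, satisfying $\rho(X)\langle Y,Y\rangle=2\langle X,Y\circ Y\rangle$ and $\rho(X)\langle Y,Y\rangle=2\langle X\circ Y,Y\rangle$. For $A=\mathrm{T}M\oplus \mathrm{T}^*M$, the anchor $\rho$ is the projection on $\mathrm{T}M$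 and the pairing is the canonical symmetric one coming from the contraction, $\langle X+\xi,Y+\eta\rangle=i_X\eta+i_Y\xi$ (up to a constant normalization). A Courant algebroid is called irreducible if the maps $\lambda I$, $\lambda\in\mathbb{R}$, are the only $(1,1)$-tensors (vector bundle morphisms over the identity) $\Delta:A\to A$ satisfying $X\circ\Delta Z=\Delta(X\circ Z)$ and $\Delta(Y\circ Y)=(\Delta Y)\circ Y$ for all sections $X,Y,Z$.
   Formalization: M is assumed connected (and non-empty): on a manifold with two components of positive dimension, a morphism equal to different constant multiples of the identity on them satisfies both conditions but is not λI. *)

theory Defs
  imports "HOL-Analysis.Analysis"
begin

text \<open>
  The manifold is the type \<open>'m\<close>, with its Hausdorff, second countable topology; its smooth structure
  is given by an atlas. The model space is a finite-dimensional inner product space \<open>'e\<close> instead of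
  a \<open>euclidean_space\<close> type, because the latter class excludes dimension 0.
\<close>

type_synonym ('m, 'e) atlas = "('m set \<times> ('m \<Rightarrow> 'e)) set"

fun ck_on :: "nat \<Rightarrow> 'a::real_normed_vector set \<Rightarrow> ('a \<Rightarrow> 'b::real_normed_vector) \<Rightarrow> bool" where
  "ck_on 0 S f \<longleftrightarrow> continuous_on S f"
| "ck_on (Suc k) S f \<longleftrightarrow>
     (\<forall>x\<in>S. f differentiable (at x)) \<and> (\<forall>v. ck_on k S (\<lambda>x. frechet_derivative f (at x) v))"

text \<open>Only used for open \<open>S\<close> in a finite-dimensional space, where it means class \<open>C\<^sup>\<infinity>\<close>.\<close>

definition smooth_on :: "'a::real_normed_vector set \<Rightarrow> ('a \<Rightarrow> 'b::real_normed_vector) \<Rightarrow> bool" where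
  "smooth_on S f \<longleftrightarrow> (\<forall>k. ck_on k S f)"

definition smooth_atlas ::
    "('m::{t2_space, second_countable_topology}, 'e::real_inner) atlas \<Rightarrow> bool" where
  "smooth_atlas A \<longleftrightarrow>
     (\<exists>B::'e set. finite B \<and> span B = UNIV) \<and>
     (\<Union>(U, \<phi>)\<in>A. U) = UNIV \<and>
     (\<forall>(U, \<phi>)\<in>A. open U \<and> open (\<phi> ` U) \<and> homeomorphism U (\<phi> ` U) \<phi> (inv_into U \<phi>)) \<and>
     (\<forall>(U, \<phi>)\<in>A. \<forall>(V, \<psi>)\<in>A. smooth_on (\<phi> ` (U \<inter> V)) (\<psi> \<circ> inv_into U \<phi>))"

definition smooth_fun :: "('m, 'e::real_inner) atlas \<Rightarrow> ('m \<Rightarrow> real) \<Rightarrow> bool" where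
  "smooth_fun A f \<longleftrightarrow> (\<forall>(U, \<phi>)\<in>A. smooth_on (\<phi> ` U) (f \<circ> inv_into U \<phi>))"


text \<open>
  Tangent vectors at \<open>p\<close> are the derivations at \<open>p\<close> of the algebra of smooth functions, and covectors
  the linear forms on the tangent space. Both are total functions, set to 0 outside their proper
  domain so that equality of (co)vectors is equality of functions.
\<close>

type_synonym 'm tvec = "('m \<Rightarrow> real) \<Rightarrow> real"
type_synonym 'm covec = "'m tvec \<Rightarrow> real"

definition tangent_space :: "('m, 'e::real_inner) atlas \<Rightarrow> 'm \<Rightarrow> 'm tvec set" where
  "tangent_space A p = {D.
     (\<forall>f g. smooth_fun A f \<longrightarrow> smooth_fun A g \<longrightarrow> D (\<lambda>x. f x + g x) = D f + D g) \<and>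
     (\<forall>c f. smooth_fun A f \<longrightarrow> D (\<lambda>x. c * f x) = c * D f) \<and>
     (\<forall>f g. smooth_fun A f \<longrightarrow> smooth_fun A g \<longrightarrow> D (\<lambda>x. f x * g x) = f p * D g + g p * D f) \<and>
     (\<forall>f. \<not> smooth_fun A f \<longrightarrow> D f = 0)}"

definition cotangent_space :: "('m, 'e::real_inner) atlas \<Rightarrow> 'm \<Rightarrow> 'm covec set" where
  "cotangent_space A p = {\<alpha>.
     (\<forall>v\<in>tangent_space A p. \<forall>w\<in>tangent_space A p. \<alpha> (\<lambda>f. v f + w f) = \<alpha> v + \<alpha> w) \<and>
     (\<forall>c. \<forall>v\<in>tangent_space A p. \<alpha> (\<lambda>f. c * v f) = c * \<alpha> v) \<and>
     (\<forall>v. v \<notin> tangent_space A p \<longrightarrow> \<alpha> v = 0)}"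

definition vector_field :: "('m, 'e::real_inner) atlas \<Rightarrow> ('m \<Rightarrow> 'm tvec) \<Rightarrow> bool" where
  "vector_field A X \<longleftrightarrow>
     (\<forall>p. X p \<in> tangent_space A p) \<and>
     (\<forall>f. smooth_fun A f \<longrightarrow> smooth_fun A (\<lambda>p. X p f))"

definition one_form :: "('m, 'e::real_inner) atlas \<Rightarrow> ('m \<Rightarrow> 'm covec) \<Rightarrow> bool" where
  "one_form A \<xi> \<longleftrightarrow>
     (\<forall>p. \<xi> p \<in> cotangent_space A p) \<and>
     (\<forall>X. vector_field A X \<longrightarrow> smooth_fun A (\<lambda>p. \<xi> p (X p)))"

definition two_form :: "('m, 'e::real_inner) atlas \<Rightarrow> ('m \<Rightarrow> 'm tvec \<Rightarrow> 'm covec) \<Rightarrow> bool" where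
  "two_form A \<omega> \<longleftrightarrow>
     (\<forall>p. \<forall>v\<in>tangent_space A p. \<omega> p v \<in> cotangent_space A p) \<and>
     (\<forall>p. \<forall>v. v \<notin> tangent_space A p \<longrightarrow> \<omega> p v = (\<lambda>w. 0)) \<and>
     (\<forall>p v w. \<omega> p v w = - \<omega> p w v) \<and>
     (\<forall>X Y. vector_field A X \<longrightarrow> vector_field A Y \<longrightarrow> smooth_fun A (\<lambda>p. \<omega> p (X p) (Y p)))"

definition lie_bracket :: "('m \<Rightarrow> 'm tvec) \<Rightarrow> ('m \<Rightarrow> 'm tvec) \<Rightarrow> 'm \<Rightarrow> 'm tvec" where
  "lie_bracket X Y = (\<lambda>p f. X p (\<lambda>q. Y q f) - Y p (\<lambda>q. X q f))"

text \<open>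
  The Lie derivative and the exterior derivative of a 1-form are the tensor fields determined by
  \<open>(\<L>\<^sub>X \<eta>)(Y) = X(\<eta>(Y)) - \<eta>([X,Y])\<close> and \<open>d\<xi>(X,Y) = X(\<xi>(Y)) - Y(\<xi>(X)) - \<xi>([X,Y])\<close>; there is no
  factor 1/2 in the latter, so that \<open>\<L>\<^sub>X = d i\<^sub>X + i\<^sub>X d\<close>.
\<close>

definition lie_derivative ::
    "('m, 'e::real_inner) atlas \<Rightarrow> ('m \<Rightarrow> 'm tvec) \<Rightarrow> ('m \<Rightarrow> 'm covec) \<Rightarrow> 'm \<Rightarrow> 'm covec" where
  "lie_derivative A X \<eta> = (THE \<zeta>. one_form A \<zeta> \<and>
     (\<forall>Y. vector_field A Y \<longrightarrow>
        (\<forall>p. \<zeta> p (Y p) = X p (\<lambda>q. \<eta> q (Y q)) - \<eta> p (lie_bracket X Y p))))"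

definition ext_derivative ::
    "('m, 'e::real_inner) atlas \<Rightarrow> ('m \<Rightarrow> 'm covec) \<Rightarrow> 'm \<Rightarrow> 'm tvec \<Rightarrow> 'm covec" where
  "ext_derivative A \<xi> = (THE \<omega>. two_form A \<omega> \<and>
     (\<forall>X Y. vector_field A X \<longrightarrow> vector_field A Y \<longrightarrow>
        (\<forall>p. \<omega> p (X p) (Y p) =
               X p (\<lambda>q. \<xi> q (Y q)) - Y p (\<lambda>q. \<xi> q (X q)) - \<xi> p (lie_bracket X Y p))))"

definition contraction ::
    "('m \<Rightarrow> 'm tvec) \<Rightarrow> ('m \<Rightarrow> 'm tvec \<Rightarrow> 'm covec) \<Rightarrow> 'm \<Rightarrow> 'm covec" where
  "contraction Y \<omega> = (\<lambda>p. \<omega> p (Y p))"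


text \<open>The bundle \<open>TM \<oplus> T\<^sup>*M\<close>; \<open>X + \<xi>\<close> is represented by the pair \<open>(X, \<xi>)\<close>.\<close>

type_synonym 'm gvec = "'m tvec \<times> 'm covec"

definition fibre :: "('m, 'e::real_inner) atlas \<Rightarrow> 'm \<Rightarrow> 'm gvec set" where
  "fibre A p = tangent_space A p \<times> cotangent_space A p"

definition gadd :: "'m gvec \<Rightarrow> 'm gvec \<Rightarrow> 'm gvec" where
  "gadd a b = (\<lambda>f. fst a f + fst b f, \<lambda>v. snd a v + snd b v)"

definition gscale :: "real \<Rightarrow> 'm gvec \<Rightarrow> 'm gvec" where
  "gscale c a = (\<lambda>f. c * fst a f, \<lambda>v. c * snd a v)"

definition smooth_section :: "('m, 'e::real_inner) atlas \<Rightarrow> ('m \<Rightarrow> 'm gvec) \<Rightarrow> bool" where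
  "smooth_section A u \<longleftrightarrow> vector_field A (\<lambda>p. fst (u p)) \<and> one_form A (\<lambda>p. snd (u p))"

definition courant_product ::
    "('m, 'e::real_inner) atlas \<Rightarrow> ('m \<Rightarrow> 'm gvec) \<Rightarrow> ('m \<Rightarrow> 'm gvec) \<Rightarrow> 'm \<Rightarrow> 'm gvec" where
  "courant_product A u v =
     (let X = (\<lambda>p. fst (u p)); \<xi> = (\<lambda>p. snd (u p)); Y = (\<lambda>p. fst (v p)); \<eta> = (\<lambda>p. snd (v p))
      in (\<lambda>p. (lie_bracket X Y p,
               \<lambda>w. lie_derivative A X \<eta> p w - contraction Y (ext_derivative A \<xi>) p w)))"

text \<open>
  A vector bundle morphism over the identity is a family of linear maps of the fibres that takes
  smooth sections to smooth sections. Its values off the fibres are irrelevant.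
\<close>

definition bundle_morphism ::
    "('m, 'e::real_inner) atlas \<Rightarrow> ('m \<Rightarrow> 'm gvec \<Rightarrow> 'm gvec) \<Rightarrow> bool" where
  "bundle_morphism A \<Delta> \<longleftrightarrow>
     (\<forall>p. \<forall>a\<in>fibre A p. \<Delta> p a \<in> fibre A p) \<and>
     (\<forall>p. \<forall>a\<in>fibre A p. \<forall>b\<in>fibre A p. \<Delta> p (gadd a b) = gadd (\<Delta> p a) (\<Delta> p b)) \<and>
     (\<forall>p c. \<forall>a\<in>fibre A p. \<Delta> p (gscale c a) = gscale c (\<Delta> p a)) \<and>
     (\<forall>u. smooth_section A u \<longrightarrow> smooth_section A (\<lambda>p. \<Delta> p (u p)))"

definition on_sections :: "('m \<Rightarrow> 'm gvec \<Rightarrow> 'm gvec) \<Rightarrow> ('m \<Rightarrow> 'm gvec) \<Rightarrow> 'm \<Rightarrow> 'm gvec" where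
  "on_sections \<Delta> u = (\<lambda>p. \<Delta> p (u p))"

definition irreducible_courant ::
    "('m, 'e::real_inner) atlas \<Rightarrow> (('m \<Rightarrow> 'm gvec) \<Rightarrow> ('m \<Rightarrow> 'm gvec) \<Rightarrow> 'm \<Rightarrow> 'm gvec) \<Rightarrow> bool" where
  "irreducible_courant A pr \<longleftrightarrow>
     (\<forall>\<Delta>. bundle_morphism A \<Delta> \<longrightarrow>
        ((\<forall>u v. smooth_section A u \<longrightarrow> smooth_section A v \<longrightarrow>
            pr u (on_sections \<Delta> v) = on_sections \<Delta> (pr u v)) \<and>
         (\<forall>v. smooth_section A v \<longrightarrow>
            on_sections \<Delta> (pr v v) = pr (on_sections \<Delta> v) v)
         \<longleftrightarrow> (\<exists>c. \<forall>p. \<forall>a\<in>fibre A p. \<Delta> p a = gscale c a)))"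

end

theory Submission
  imports Defs
begin

text \<open>
  Replacing \<open>X\<close> by \<open>f X\<close> in \<open>X \<circ> \<Delta> v = \<Delta> (X \<circ> v)\<close> gives a pointwise condition: for
  \<open>\<Delta> (Y + \<eta>) = Y' + \<eta>'\<close>, the morphism \<open>\<Delta>\<close> maps \<open>- Y(f) X + \<eta>(X) df\<close> to
  \<open>- Y'(f) X + \<eta>'(X) df\<close>. On each fibre this forces \<open>\<Delta> (Y + \<eta>) = \<kappa> Y + \<mu> \<eta>\<close>. Then
  \<open>[X, \<kappa> Y] = \<kappa> [X, Y]\<close> makes \<open>\<kappa>\<close> locally constant, and evaluating
  \<open>\<Delta> (v \<circ> v) = \<Delta> v \<circ> v\<close>, for \<open>v = Y + \<eta>\<close>, on \<open>Y\<close> gives \<open>\<mu> Y(\<eta>(Y)) = \<kappa> Y(\<eta>(Y))\<close>, hence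
  \<open>\<mu> = \<kappa>\<close>. Since tangent vectors are derivations, extending them to vector fields and constructing
  the exterior derivative requires Hadamard's lemma and bump functions.
\<close>

section \<open>Smooth functions on inner product spaces of finite dimension\<close>

text \<open>Derivations act on functions defined on the whole manifold, so every computation in a
  chart must become an identity valid everywhere. Multiplying by powers of a cutoff function does
  this; the exponent counts the factors that have to be cut off: two in Hadamard's expansion of a
  function, three in the expansion of a vector field in a local frame.

  The two conditions on \<Delta> play different roles. In dimension 1 all 2-forms vanish, and any
  constants \<kappa> and \<mu> satisfy the first condition; the second one is what links \<mu> to
  \<kappa>. It compares them point by point, so \<mu> is constant as soon as \<kappa> is.

  Connectedness enters when the locally constant \<kappa> is to be constant: on two components of
  positive dimension, two different scalars would satisfy both conditions. Dimension 0 is treated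
  apart, because the scalars are read off from a tangent vector x and a function f with x f =
  1.\<close>

text \<open>Frames stand in for \<open>Basis\<close>, since the model space is not of class
  \<open>euclidean_space\<close>.\<close>

definition frame :: "'e::real_inner set \<Rightarrow> bool" where
  "frame B \<longleftrightarrow> finite B \<and> (\<forall>x. (\<Sum>b\<in>B. (x \<bullet> b) *\<^sub>R b) = x)"

text \<open>Besides finiteness, \<open>frame\<close> records just the reconstruction formula of a
  Parseval frame. It holds on the members of a normalised orthogonal spanning set and extends to
  their span by linearity.\<close>

lemma frame_exists:
  fixes B :: "'e::real_inner set"
  assumes "finite B" "span B = UNIV"
  obtains C :: "'e set" where "frame C"
proof -
  obtain C :: "'e set" where C: "finite C" "span C = UNIV" "pairwise orthogonal C"
    using basis_orthogonal[OF assms(1)] assms(2) by auto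
  \<comment> \<open>An orthogonal spanning set may contain 0, which cannot be normalised.\<close>
  define D where "D = (\<lambda>x. x /\<^sub>R norm x) ` (C - {0})"
  have D: "finite D" "\<And>x. x \<in> D \<Longrightarrow> x \<bullet> x = 1"
    using C(1) by (auto simp: D_def dot_square_norm power2_eq_square divide_simps split: if_splits)
  have orth: "x \<bullet> y = 0" if xy: "x \<in> D" "y \<in> D" "x \<noteq> y" for x y
  proof -
    obtain a b where ab: "a \<in> C" "b \<in> C" "x = a /\<^sub>R norm a" "y = b /\<^sub>R norm b"
      using xy(1,2) unfolding D_def by blast
    with xy(3) have "a \<noteq> b" by blast
    with C(3) ab(1,2) have "a \<bullet> b = 0" by (auto simp: pairwise_def orthogonal_def)
    then show ?thesis by (simp add: ab)
  qed
  have inD: "c \<in> span D" if "c \<in> C" for c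
  proof (cases "c = 0")
    case False
    then have "c /\<^sub>R norm c \<in> D" using that by (auto simp: D_def)
    then have "norm c *\<^sub>R (c /\<^sub>R norm c) \<in> span D"
      by (intro span_mul span_base)
    then show ?thesis using False by simp
  qed (simp add: span_zero)
  then have "span C \<subseteq> span D"
    using inD by (intro span_minimal) auto
  then have span: "x \<in> span D" for x using C(2) by auto
  have "(\<Sum>b\<in>D. (x \<bullet> b) *\<^sub>R b) = x" for x
    using span[of x]
  proof (induction x rule: span_induct_alt)
    case base
    then show ?case by simp
  next
    case (step c x y)
    have "(\<Sum>b\<in>D. (x \<bullet> b) *\<^sub>R b) = (\<Sum>b\<in>D. if b = x then x else 0)"
      by (rule sum.cong) (use step.hyps D(2) orth in auto)
    also have "\<dots> = x" using step.hyps D(1) by simp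
    finally have "(\<Sum>b\<in>D. (x \<bullet> b) *\<^sub>R b) = x" .
    moreover have "(\<Sum>b\<in>D. ((c *\<^sub>R x + y) \<bullet> b) *\<^sub>R b) =
        c *\<^sub>R (\<Sum>b\<in>D. (x \<bullet> b) *\<^sub>R b) + (\<Sum>b\<in>D. (y \<bullet> b) *\<^sub>R b)"
      by (simp add: inner_add_left scaleR_add_left sum.distrib scaleR_sum_right)
    ultimately show ?case using step by simp
  qed
  then show thesis using that D(1) by (auto simp: frame_def)
qed

lemma frame_real: "frame {1::real}"
  by (simp add: frame_def)

lemma frame_finite: "frame B \<Longrightarrow> finite B"
  and frame_expand: "frame B \<Longrightarrow> (\<Sum>b\<in>B. (x \<bullet> b) *\<^sub>R b) = x"
  by (simp_all add: frame_def)

lemma linear_frame_expand: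
  assumes "frame B" "linear f"
  shows "f x = (\<Sum>b\<in>B. (x \<bullet> b) *\<^sub>R f b)"
proof -
  have "f x = f (\<Sum>b\<in>B. (x \<bullet> b) *\<^sub>R b)" using assms(1) by (simp add: frame_expand)
  also have "\<dots> = (\<Sum>b\<in>B. (x \<bullet> b) *\<^sub>R f b)"
    using assms(2) by (simp add: linear_sum linear_scale)
  finally show ?thesis .
qed

text \<open>Heine-Borel for the model space: a coordinate box \<open>K C\<close> is a sum of
  finitely many compact segments, and by Cauchy-Schwarz \<open>cball 0 r\<close> is a closed subset
  of \<open>K B\<close>.\<close>

lemma compact_cball_frame:
  fixes c :: "'e::real_inner" and B :: "'e set"
  assumes "frame B"
  shows "compact (cball c r)"
proof -
  define K where "K C = {\<Sum>b\<in>C. s b *\<^sub>R b |s::'e \<Rightarrow> real. \<forall>b\<in>C. \<bar>s b\<bar> \<le> r * norm b}" for C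
  have K: "compact (K C)" if "finite C" for C
    using that
  proof (induction C)
    case empty
    then show ?case by (simp add: K_def)
  next
    case (insert a C)
    have 1: "compact ((\<lambda>s. s *\<^sub>R a) ` {- (r * norm a)..r * norm a})"
      by (intro compact_continuous_image continuous_intros compact_Icc)
    have "K (insert a C) = {x + y |x y. x \<in> (\<lambda>s. s *\<^sub>R a) ` {- (r * norm a)..r * norm a} \<and> y \<in> K C}"
      (is "_ = ?R")
    proof
      show "K (insert a C) \<subseteq> ?R"
      proof
        fix z assume "z \<in> K (insert a C)"
        then obtain s where s: "z = (\<Sum>b\<in>insert a C. s b *\<^sub>R b)"
          "\<forall>b\<in>insert a C. \<bar>s b\<bar> \<le> r * norm b"
          unfolding K_def by blast
        have "z = s a *\<^sub>R a + (\<Sum>b\<in>C. s b *\<^sub>R b)" using s(1) insert.hyps by simp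
        moreover have "s a *\<^sub>R a \<in> (\<lambda>s. s *\<^sub>R a) ` {- (r * norm a)..r * norm a}"
          using s(2) by (intro imageI) (auto simp: abs_le_iff)
        moreover have "(\<Sum>b\<in>C. s b *\<^sub>R b) \<in> K C" using s(2) unfolding K_def by blast
        ultimately show "z \<in> ?R" by blast
      qed
      show "?R \<subseteq> K (insert a C)"
      proof
        fix z assume "z \<in> ?R"
        then obtain s0 s where s: "z = s0 *\<^sub>R a + (\<Sum>b\<in>C. s b *\<^sub>R b)" "\<bar>s0\<bar> \<le> r * norm a"
          "\<forall>b\<in>C. \<bar>s b\<bar> \<le> r * norm b"
          unfolding K_def image_iff mem_Collect_eq
          by (metis abs_le_iff atLeastAtMost_iff minus_le_iff)
        have "(\<Sum>b\<in>C. s b *\<^sub>R b) = (\<Sum>b\<in>C. (s(a := s0)) b *\<^sub>R b)"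
          using insert.hyps by (intro sum.cong) auto
        then have "z = (\<Sum>b\<in>insert a C. (s(a := s0)) b *\<^sub>R b)"
          using s(1) insert.hyps by simp
        moreover have "\<forall>b\<in>insert a C. \<bar>(s(a := s0)) b\<bar> \<le> r * norm b"
          using s by auto
        ultimately show "z \<in> K (insert a C)" unfolding K_def by blast
      qed
    qed
    then show ?case using compact_sums[OF 1 insert.IH] by simp
  qed
  have "cball 0 r \<subseteq> K B"
  proof
    fix x :: 'e assume "x \<in> cball 0 r"
    then have n: "norm x \<le> r" by simp
    have "\<forall>b\<in>B. \<bar>x \<bullet> b\<bar> \<le> r * norm b"
      by (meson n Cauchy_Schwarz_ineq2 mult_right_mono norm_ge_zero order_trans)
    then show "x \<in> K B"
      unfolding K_def mem_Collect_eq using frame_expand[OF assms, of x, symmetric]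
      by (intro exI[of _ "\<lambda>b. x \<bullet> b"] conjI)
  qed
  then have "compact (K B \<inter> cball 0 r)" "K B \<inter> cball 0 r = cball 0 r"
    using K[OF frame_finite[OF assms]] by (auto intro: compact_Int_closed)
  then have "compact ((+) c ` cball 0 r)" by (intro compact_translation) simp
  then show ?thesis by (simp add: cball_translation)
qed


section \<open>Calculus of functions of class C^k and of smooth functions\<close>

lemma ck_on_cong:
  assumes "open S" "\<And>x. x \<in> S \<Longrightarrow> f x = g x" "ck_on k S f"
  shows "ck_on k S g"
  using assms(2,3)
proof (induction k arbitrary: f g)
  case 0
  then show ?case by (simp cong: continuous_on_cong)
next
  case (Suc k)
  have diff: "g differentiable (at x)" if "x \<in> S" for x
  proof -
    have "(f has_derivative frechet_derivative f (at x)) (at x)"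
      using Suc.prems(2) that by (simp add: frechet_derivative_works)
    from has_derivative_transform_within_open[OF this assms(1) that Suc.prems(1)]
    show ?thesis by (rule differentiableI)
  qed
  have "ck_on k S (\<lambda>x. frechet_derivative g (at x) v)" for v
  proof (rule Suc.IH)
    show "ck_on k S (\<lambda>x. frechet_derivative f (at x) v)" using Suc.prems by simp
    show "frechet_derivative f (at x) v = frechet_derivative g (at x) v" if "x \<in> S" for x
      using frechet_derivative_transform_within_open[of f x S g] Suc.prems that assms(1) by simp
  qed
  then show ?case using diff by simp
qed

lemma ck_on_subset: "ck_on k S f \<Longrightarrow> T \<subseteq> S \<Longrightarrow> ck_on k T f"
  by (induction k arbitrary: f) (auto intro: continuous_on_subset)

lemma ck_on_Un:
  assumes "open S" "open T"
  shows "ck_on k S f \<Longrightarrow> ck_on k T f \<Longrightarrow> ck_on k (S \<union> T) f"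
  by (induction k arbitrary: f) (use assms in \<open>auto intro: continuous_on_open_Un\<close>)

lemma ck_on_SucD: "ck_on (Suc k) S f \<Longrightarrow> ck_on k S f"
proof (induction k arbitrary: f)
  case 0
  then show ?case
    by (auto intro!: continuous_at_imp_continuous_on differentiable_imp_continuous_within)
qed auto

lemma ck_on_const [simp]: "ck_on k S (\<lambda>x. c)"
  by (induction k arbitrary: c) auto

lemma ck_on_bounded_linear_compose:
  assumes "bounded_linear L" "open S"
  shows "ck_on k S f \<Longrightarrow> ck_on k S (\<lambda>x. L (f x))"
proof (induction k arbitrary: f)
  case 0
  then show ?case using assms by (simp add: bounded_linear.continuous_on)
next
  case (Suc k)
  have d: "((\<lambda>x. L (f x)) has_derivative (\<lambda>v. L (frechet_derivative f (at x) v))) (at x)"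
    if "x \<in> S" for x
    by (rule bounded_linear.has_derivative[OF assms(1)])
       (use Suc.prems that in \<open>simp add: frechet_derivative_works\<close>)
  have "ck_on k S (\<lambda>x. frechet_derivative (\<lambda>x. L (f x)) (at x) v)" for v
    by (rule ck_on_cong[OF assms(2) _ Suc.IH[of "\<lambda>x. frechet_derivative f (at x) v"]])
       (use Suc.prems frechet_derivative_at[OF d] in \<open>auto simp: fun_eq_iff\<close>)
  then show ?case using d by (auto simp: differentiable_def)
qed

lemma ck_on_add:
  assumes "open S"
  shows "ck_on k S f \<Longrightarrow> ck_on k S g \<Longrightarrow> ck_on k S (\<lambda>x. f x + g x)"
proof (induction k arbitrary: f g)
  case 0
  then show ?case by (auto intro: continuous_intros)
next
  case (Suc k)
  have d: "((\<lambda>x. f x + g x) has_derivative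
      (\<lambda>v. frechet_derivative f (at x) v + frechet_derivative g (at x) v)) (at x)"
    if "x \<in> S" for x
    using Suc.prems that by (auto simp: frechet_derivative_works intro: has_derivative_add)
  have "ck_on k S (\<lambda>x. frechet_derivative (\<lambda>x. f x + g x) (at x) v)" for v
    by (rule ck_on_cong[OF assms _ Suc.IH[of "\<lambda>x. frechet_derivative f (at x) v"
            "\<lambda>x. frechet_derivative g (at x) v"]])
       (use Suc.prems frechet_derivative_at[OF d] in \<open>auto simp: fun_eq_iff\<close>)
  then show ?case using d by (auto simp: differentiable_def)
qed

lemma frechet_derivative_mult:
  fixes f g :: "'a::real_normed_vector \<Rightarrow> real"
  assumes "f differentiable (at x)" "g differentiable (at x)"
  shows "frechet_derivative (\<lambda>x. f x * g x) (at x) v =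
    f x * frechet_derivative g (at x) v + frechet_derivative f (at x) v * g x"
proof -
  have "((\<lambda>x. f x * g x) has_derivative
      (\<lambda>v. f x * frechet_derivative g (at x) v + frechet_derivative f (at x) v * g x)) (at x)"
    using assms by (auto simp: frechet_derivative_works intro: has_derivative_mult)
  from fun_cong[OF frechet_derivative_at[OF this]] show ?thesis by simp
qed

lemma ck_on_mult:
  fixes f g :: "'a::real_normed_vector \<Rightarrow> real"
  assumes "open S"
  shows "ck_on k S f \<Longrightarrow> ck_on k S g \<Longrightarrow> ck_on k S (\<lambda>x. f x * g x)"
proof (induction k arbitrary: f g)
  case 0
  then show ?case by (auto intro: continuous_intros)
next
  case (Suc k)
  have "ck_on k S f" "ck_on k S g" using Suc.prems[THEN ck_on_SucD] .
  then have "ck_on k S (\<lambda>x. f x * frechet_derivative g (at x) v + frechet_derivative f (at x) v * g x)"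
    for v
    using Suc.prems by (intro ck_on_add[OF assms] Suc.IH) auto
  then have "ck_on k S (\<lambda>x. frechet_derivative (\<lambda>x. f x * g x) (at x) v)" for v
    by (rule ck_on_cong[OF assms, rotated])
       (use Suc.prems in \<open>simp add: frechet_derivative_mult\<close>)
  then show ?case using Suc.prems by auto
qed

lemma ck_on_sum:
  assumes "open S" "\<And>i. i \<in> I \<Longrightarrow> ck_on k S (f i)"
  shows "ck_on k S (\<lambda>x. \<Sum>i\<in>I. f i x)"
  using assms(2)
  by (induction I rule: infinite_finite_induct) (auto intro: ck_on_add[OF assms(1)])


lemma smooth_on_ck_on: "smooth_on S f \<Longrightarrow> ck_on k S f"
  by (simp add: smooth_on_def)

lemma smooth_on_differentiable: "smooth_on S f \<Longrightarrow> x \<in> S \<Longrightarrow> f differentiable (at x)"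
  by (metis ck_on.simps(2) smooth_on_def)

lemma smooth_on_continuous_on: "smooth_on S f \<Longrightarrow> continuous_on S f"
  by (metis ck_on.simps(1) smooth_on_def)

lemma smooth_on_frechet_derivative:
  assumes "smooth_on S f"
  shows "smooth_on S (\<lambda>x. frechet_derivative f (at x) v)"
proof -
  have "ck_on (Suc k) S f" for k using assms by (simp only: smooth_on_def)
  then show ?thesis by (simp add: smooth_on_def)
qed

lemma smooth_on_cong:
  "open S \<Longrightarrow> (\<And>x. x \<in> S \<Longrightarrow> f x = g x) \<Longrightarrow> smooth_on S f \<Longrightarrow> smooth_on S g"
  by (meson ck_on_cong smooth_on_def)

lemma smooth_on_subset: "smooth_on S f \<Longrightarrow> T \<subseteq> S \<Longrightarrow> smooth_on T f"
  by (meson ck_on_subset smooth_on_def)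

lemma smooth_on_Un:
  "open S \<Longrightarrow> open T \<Longrightarrow> smooth_on S f \<Longrightarrow> smooth_on T f \<Longrightarrow> smooth_on (S \<union> T) f"
  by (meson ck_on_Un smooth_on_def)

lemma smooth_on_const [simp]: "smooth_on S (\<lambda>x. c)"
  by (simp add: smooth_on_def)

lemma smooth_on_add:
  "open S \<Longrightarrow> smooth_on S f \<Longrightarrow> smooth_on S g \<Longrightarrow> smooth_on S (\<lambda>x. f x + g x)"
  by (simp add: ck_on_add smooth_on_def)

lemma smooth_on_mult:
  fixes f g :: "'a::real_normed_vector \<Rightarrow> real"
  shows "open S \<Longrightarrow> smooth_on S f \<Longrightarrow> smooth_on S g \<Longrightarrow> smooth_on S (\<lambda>x. f x * g x)"
  by (simp add: ck_on_mult smooth_on_def)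

lemma smooth_on_sum:
  "open S \<Longrightarrow> (\<And>i. i \<in> I \<Longrightarrow> smooth_on S (f i)) \<Longrightarrow> smooth_on S (\<lambda>x. \<Sum>i\<in>I. f i x)"
  by (simp add: ck_on_sum smooth_on_def)

lemma smooth_on_bounded_linear:
  assumes "bounded_linear L"
  shows "smooth_on S L"
proof -
  have "ck_on k S L" for k
  proof (cases k)
    case 0
    then show ?thesis using assms by (simp add: linear_continuous_on)
  next
    case (Suc n)
    have "frechet_derivative L (at x) v = L v" for x v
      using frechet_derivative_at[OF bounded_linear_imp_has_derivative[OF assms]] by metis
    then show ?thesis
      using Suc bounded_linear_imp_differentiable[OF assms] by simp
  qed
  then show ?thesis by (simp add: smooth_on_def)
qed

lemma smooth_on_inner_left: "smooth_on S (\<lambda>x. x \<bullet> b)"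
  by (intro smooth_on_bounded_linear bounded_linear_inner_left)

text \<open>The derivative of the composition is expanded in the frame, so that only products of
  real-valued functions occur.\<close>

lemma ck_on_compose:
  fixes g :: "'a::real_normed_vector \<Rightarrow> 'c::real_inner" and h :: "'c \<Rightarrow> real" and B :: "'c set"
  assumes B: "frame B" and "open S" and g: "smooth_on S g" and "g ` S \<subseteq> T"
  shows "ck_on k T h \<Longrightarrow> ck_on k S (\<lambda>x. h (g x))"
proof (induction k arbitrary: h)
  case 0
  then show ?case
    using continuous_on_compose2[OF _ smooth_on_continuous_on[OF g] assms(4)] by simp
next
  case (Suc k)
  have gd: "g differentiable (at x)" if "x \<in> S" for x
    using g that by (rule smooth_on_differentiable)
  have hd: "h differentiable (at (g x))" if "x \<in> S" for x
    using Suc.prems that assms(4) by auto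
  have eq: "frechet_derivative (\<lambda>x. h (g x)) (at x) v =
      (\<Sum>b\<in>B. (frechet_derivative g (at x) v \<bullet> b) * frechet_derivative h (at (g x)) b)"
    if "x \<in> S" for x v
  proof -
    have "frechet_derivative (\<lambda>x. h (g x)) (at x) v =
        frechet_derivative h (at (g x)) (frechet_derivative g (at x) v)"
      using frechet_derivative_compose[OF gd hd, OF that that] by (simp add: o_def)
    also have "\<dots> = (\<Sum>b\<in>B. (frechet_derivative g (at x) v \<bullet> b) * frechet_derivative h (at (g x)) b)"
      by (subst linear_frame_expand[OF B linear_frechet_derivative[OF hd[OF that]]]) simp
    finally show ?thesis .
  qed
  have "ck_on k S (\<lambda>x. frechet_derivative (\<lambda>x. h (g x)) (at x) v)" for v
  proof (rule ck_on_cong[OF \<open>open S\<close> eq[symmetric]])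
    show "ck_on k S (\<lambda>x. \<Sum>b\<in>B. (frechet_derivative g (at x) v \<bullet> b) * frechet_derivative h (at (g x)) b)"
    proof (intro ck_on_sum ck_on_mult \<open>open S\<close> Suc.IH)
      \<comment> \<open>The induction varies \<open>h\<close> only, so the factor coming from
        \<open>g\<close> must be of class C^k at every stage; this is why \<open>g\<close> is taken
        smooth.\<close>
      show "ck_on k S (\<lambda>x. frechet_derivative g (at x) v \<bullet> b)" for b
        by (intro ck_on_bounded_linear_compose[OF bounded_linear_inner_left] \<open>open S\<close>
            smooth_on_ck_on smooth_on_frechet_derivative g)
      show "ck_on k T (\<lambda>x. frechet_derivative h (at x) b)" for b using Suc.prems by simp
    qed
  qed auto
  then show ?case
    using differentiable_chain_at[OF gd hd] by (auto simp: o_def)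
qed

lemma smooth_on_compose:
  fixes g :: "'a::real_normed_vector \<Rightarrow> 'c::real_inner" and h :: "'c \<Rightarrow> real" and B :: "'c set"
  assumes "frame B" "open S" "smooth_on S g" "g ` S \<subseteq> T" "smooth_on T h"
  shows "smooth_on S (\<lambda>x. h (g x))"
  using ck_on_compose[OF assms(1-4)] assms(5) by (simp add: smooth_on_def)


text \<open>The derivative of each member of this family is a linear combination of members, so
  smoothness follows by induction.\<close>

definition flat :: "nat \<Rightarrow> real \<Rightarrow> real" where
  "flat k t = (if t > 0 then exp (- inverse t) * inverse t ^ k else 0)"

lemma flat_nonneg: "0 \<le> flat k t"
  by (simp add: flat_def)

text \<open>Put s = 1/t and n = k + 2. The bound s/n \<le> exp (s/n), raised to the power n, gives
  s^n \<le> n^n * exp s. The two powers of s beyond s^k become the factor t^2, which makes the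
  difference quotient at 0 tend to 0.\<close>

lemma flat_le: "flat k t \<le> real (k + 2) ^ (k + 2) * t\<^sup>2"
proof (cases "t > 0")
  case True
  define n where "n = k + 2"
  define s where "s = inverse t"
  have s: "s > 0" "t = inverse s" and n: "real n > 0" using True by (auto simp: s_def n_def)
  have "s / real n \<le> exp (s / real n)"
    using exp_ge_add_one_self[of "s / real n"] by linarith
  then have "(s / real n) ^ n \<le> exp (s / real n) ^ n"
    using s by (intro power_mono) auto
  also have "\<dots> = exp s"
    using n by (simp flip: exp_of_nat_mult)
  finally have "s ^ n \<le> real n ^ n * exp s"
    using n by (simp add: power_divide divide_le_eq mult.commute)
  then have "exp (- s) * s ^ n \<le> real n ^ n"
    by (simp add: exp_minus field_simps)
  then have "exp (- s) * s ^ k * s\<^sup>2 \<le> real n ^ n"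
    by (simp add: n_def power_add mult_ac power2_eq_square)
  then have "exp (- s) * s ^ k * s\<^sup>2 * t\<^sup>2 \<le> real n ^ n * t\<^sup>2"
    by (rule mult_right_mono) simp
  moreover have "s\<^sup>2 * t\<^sup>2 = 1" using s by (simp flip: power_mult_distrib)
  ultimately have "exp (- s) * s ^ k \<le> real n ^ n * t\<^sup>2"
    by (simp add: mult.assoc)
  then show ?thesis using True by (simp add: flat_def s_def n_def)
qed (simp add: flat_def)

text \<open>For t > 0 the exponential contributes a factor t^-2 and the power a factor - k * t^-1.
  At 0 the derivative is 0, since \<open>flat_le\<close> bounds the difference quotient by a
  multiple of |h|.\<close>

lemma flat_has_derivative:
  "(flat k has_real_derivative (flat (k + 2) x - k * flat (k + 1) x)) (at x)"
proof -
  consider "x < 0" | "x > 0" | "x = 0" by linarith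
  then show ?thesis
  proof cases
    case 1
    have "((\<lambda>_::real. 0) has_real_derivative 0) (at x)" by simp
    then have "(flat k has_real_derivative 0) (at x)"
      by (rule has_field_derivative_transform_within_open[where S = "{..<0}"]) (use 1 in \<open>auto simp: flat_def\<close>)
    then show ?thesis using 1 by (simp add: flat_def)
  next
    case 2
    have i: "(inverse has_real_derivative - (inverse x ^ 2)) (at x)"
      using DERIV_inverse[of x] 2 by (simp add: numeral_2_eq_2)
    have "((\<lambda>t. exp (- inverse t)) has_real_derivative exp (- inverse x) * inverse x ^ 2) (at x)"
      using DERIV_fun_exp[OF DERIV_minus[OF i]] by simp
    from DERIV_mult[OF this DERIV_power[OF i, of k]]
    have "((\<lambda>t. exp (- inverse t) * inverse t ^ k) has_real_derivative
        (flat (k + 2) x - k * flat (k + 1) x)) (at x)"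
      by (rule DERIV_cong)
         (use 2 in \<open>cases k; simp add: flat_def power_add power2_eq_square algebra_simps\<close>)
    then show ?thesis
      by (rule has_field_derivative_transform_within_open[where S = "{0<..}"]) (use 2 in \<open>auto simp: flat_def\<close>)
  next
    case 3
    have "((\<lambda>h. (flat k (0 + h) - flat k 0) / h) \<longlongrightarrow> 0) (at 0)"
    proof (rule Lim_null_comparison)
      show "\<forall>\<^sub>F h in at 0. norm ((flat k (0 + h) - flat k 0) / h) \<le> real (k + 2) ^ (k + 2) * \<bar>h\<bar>"
      proof (intro always_eventually allI)
        fix h :: real
        have "\<bar>flat k h\<bar> \<le> real (k + 2) ^ (k + 2) * \<bar>h\<bar> * \<bar>h\<bar>"
          using flat_le[of k h] flat_nonneg[of k h] by (simp add: power2_eq_square mult.assoc)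
        then show "norm ((flat k (0 + h) - flat k 0) / h) \<le> real (k + 2) ^ (k + 2) * \<bar>h\<bar>"
          by (cases "h = 0") (auto simp: flat_def[of k 0] divide_le_eq)
      qed
      show "((\<lambda>h. real (k + 2) ^ (k + 2) * \<bar>h\<bar>) \<longlongrightarrow> 0) (at (0::real))"
        by (rule tendsto_eq_intros | simp)+
    qed
    then show ?thesis using 3 by (simp add: DERIV_def flat_def)
  qed
qed

lemma ck_on_flat: "ck_on n UNIV (flat k)"
proof (induction n arbitrary: k)
  case 0
  then show ?case
    by (auto intro!: continuous_at_imp_continuous_on DERIV_isCont flat_has_derivative)
next
  case (Suc n)
  have d: "(flat k has_derivative (\<lambda>v. (flat (k + 2) x - k * flat (k + 1) x) * v)) (at x)" for x
    using flat_has_derivative by (simp add: has_field_derivative_def)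
  have "ck_on n UNIV (\<lambda>x. (flat (k + 2) x + - real k * flat (k + 1) x) * v)" for v
    by (intro ck_on_mult ck_on_add ck_on_const Suc.IH open_UNIV)
  moreover have "frechet_derivative (flat k) (at x) v = (flat (k + 2) x + - real k * flat (k + 1) x) * v"
    for x v
    using fun_cong[OF frechet_derivative_at[OF d[of x]], of v] by simp
  ultimately show ?case
    using differentiableI[OF d] by simp
qed

text \<open>The function \<open>flat 0\<close> of r^2 - |x - c|^2 is positive exactly inside the
  ball; dividing by its value at c normalises it. The squared norm is expanded in the frame to
  become a polynomial in the linear functions \<open>x \<bullet> b\<close>.\<close>

lemma bump_exists:
  fixes B :: "'e::real_inner set" and c :: 'e
  assumes B: "frame B" and "r > 0"
  obtains \<phi> :: "'e \<Rightarrow> real"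
  where "smooth_on UNIV \<phi>" "\<phi> c = 1" "\<And>x. x \<notin> ball c r \<Longrightarrow> \<phi> x = 0"
proof -
  define q where "q x = r\<^sup>2 - (x - c) \<bullet> (x - c)" for x
  have q: "q = (\<lambda>x. r\<^sup>2 + (\<Sum>b\<in>B. - 1 * ((x \<bullet> b + - (c \<bullet> b)) * (x \<bullet> b + - (c \<bullet> b)))))"
  proof
    fix x
    have "(x - c) \<bullet> (x - c) = (x - c) \<bullet> (\<Sum>b\<in>B. ((x - c) \<bullet> b) *\<^sub>R b)"
      by (simp only: frame_expand[OF B])
    also have "\<dots> = (\<Sum>b\<in>B. (x \<bullet> b + - (c \<bullet> b)) * (x \<bullet> b + - (c \<bullet> b)))"
      unfolding inner_sum_right by (intro sum.cong) (auto simp: inner_diff_left)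
    finally show "q x = r\<^sup>2 + (\<Sum>b\<in>B. - 1 * ((x \<bullet> b + - (c \<bullet> b)) * (x \<bullet> b + - (c \<bullet> b))))"
      by (simp add: q_def sum_negf)
  qed
  have "smooth_on UNIV q"
    unfolding q
    by (rule smooth_on_add smooth_on_sum smooth_on_mult smooth_on_const smooth_on_inner_left open_UNIV)+
  moreover have "smooth_on UNIV (flat 0)"
    by (simp add: smooth_on_def ck_on_flat)
  ultimately have "smooth_on UNIV (\<lambda>x. flat 0 (q x))"
    by (rule smooth_on_compose[OF frame_real open_UNIV _ subset_UNIV])
  then have "smooth_on UNIV (\<lambda>x. inverse (flat 0 (q c)) * flat 0 (q x))"
    by (intro smooth_on_mult smooth_on_const open_UNIV)
  moreover have "flat 0 (q c) \<noteq> 0" using \<open>r > 0\<close> by (simp add: flat_def q_def)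
  moreover have "flat 0 (q x) = 0" if "x \<notin> ball c r" for x
  proof -
    have "r \<le> norm (x - c)" using that by (simp add: dist_norm norm_minus_commute)
    then have "r\<^sup>2 \<le> (norm (x - c))\<^sup>2" using \<open>r > 0\<close> by (intro power_mono) auto
    then show ?thesis by (simp add: flat_def q_def power2_norm_eq_inner)
  qed
  ultimately show thesis using that by simp
qed

section \<open>Integrals with parameters and Hadamard's lemma\<close>

text \<open>Differentiation under the integral sign. Once the linear map given by the partial
  derivatives at x is subtracted, the integrand \<open>H\<close> has small derivative near x,
  uniformly in t. The mean value inequality bounds its increments, and integration over t keeps the
  bound.\<close>

lemma has_derivative_integral_frame:
  fixes F :: "'a::real_inner \<Rightarrow> real \<Rightarrow> real" and g :: "'a \<Rightarrow> 'a \<Rightarrow> real \<Rightarrow> real" and B :: "'a set"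
  assumes B: "frame B" and U: "open U" and x: "x \<in> U"
    and der: "\<And>y t. y \<in> U \<Longrightarrow> t \<in> {0..1} \<Longrightarrow>
      ((\<lambda>y. F y t) has_derivative (\<lambda>v. \<Sum>b\<in>B. (v \<bullet> b) * g b y t)) (at y)"
    and cF: "\<And>y. y \<in> U \<Longrightarrow> continuous_on {0..1} (F y)"
    and cg: "\<And>b. b \<in> B \<Longrightarrow> continuous_on (U \<times> {0..1}) (\<lambda>(y, t). g b y t)"
  shows "((\<lambda>y. integral {0..1} (F y)) has_derivative
    (\<lambda>v. \<Sum>b\<in>B. (v \<bullet> b) * integral {0..1} (g b x))) (at x)"
  unfolding has_derivative_at_alt
proof (intro conjI allI impI)
  show "bounded_linear (\<lambda>v. \<Sum>b\<in>B. (v \<bullet> b) * integral {0..1} (g b x))"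
    by (intro bounded_linear_sum bounded_linear_mult_const bounded_linear_inner_left)
next
  fix e :: real assume "e > 0"
  define S where "S = (\<Sum>b\<in>B. norm b)"
  \<comment> \<open>The operator norm will be bounded by \<open>S * e'\<close>. The summand 1 keeps
    the denominator positive in dimension 0, where \<open>S\<close> is 0.\<close>
  define e' where "e' = e / (S + 1)"
  have S: "S \<ge> 0" unfolding S_def by (intro sum_nonneg) auto
  then have e': "e' > 0" "S * e' \<le> e" using \<open>e > 0\<close> by (auto simp: e'_def field_simps)
  have cgx: "continuous_on {0..1} (g b y)" if "b \<in> B" "y \<in> U" for b y
    using continuous_on_compose2[OF cg[OF that(1)], of "{0..1}" "\<lambda>t. (y, t)"] that(2)
      continuous_on_Pair[OF continuous_on_const continuous_on_id, of "{0..1}" y]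
    by auto
  \<comment> \<open>A tube lemma: the parameter interval is compact, so one neighbourhood of x
    serves all t.\<close>
  have near: "\<exists>X. x \<in> X \<and> open X \<and> (\<forall>y\<in>X \<inter> U. \<forall>t\<in>{0..1}. \<bar>g b y t - g b x t\<bar> \<le> e')" if "b \<in> B" for b
    by (rule continuous_on_prod_compactE[OF cg[OF that] compact_Icc x e'(1)])
       (auto simp: dist_real_def)
  obtain X where X: "\<And>b. b \<in> B \<Longrightarrow> x \<in> X b" "\<And>b. b \<in> B \<Longrightarrow> open (X b)"
    "\<And>b y t. b \<in> B \<Longrightarrow> y \<in> X b \<Longrightarrow> y \<in> U \<Longrightarrow> t \<in> {0..1} \<Longrightarrow> \<bar>g b y t - g b x t\<bar> \<le> e'"
  proof -
    have "\<forall>b\<in>B. \<exists>X. x \<in> X \<and> open X \<and> (\<forall>y\<in>X \<inter> U. \<forall>t\<in>{0..1}. \<bar>g b y t - g b x t\<bar> \<le> e')"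
      using near by blast
    from bchoice[OF this] obtain X where
      "\<forall>b\<in>B. x \<in> X b \<and> open (X b) \<and> (\<forall>y\<in>X b \<inter> U. \<forall>t\<in>{0..1}. \<bar>g b y t - g b x t\<bar> \<le> e')" ..
    then show thesis by (intro that[of X]) auto
  qed
  have "open (U \<inter> (\<Inter>b\<in>B. X b))" "x \<in> U \<inter> (\<Inter>b\<in>B. X b)"
    using X(1,2) U x frame_finite[OF B] by (auto intro!: open_INT)
  then obtain d where d: "d > 0" "ball x d \<subseteq> U \<inter> (\<Inter>b\<in>B. X b)"
    by (meson openE)
  have "norm (integral {0..1} (F y) - integral {0..1} (F x) -
      (\<Sum>b\<in>B. ((y - x) \<bullet> b) * integral {0..1} (g b x))) \<le> e * norm (y - x)"
    if y: "norm (y - x) < d" for y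
  proof -
    have yb: "y \<in> ball x d" "x \<in> ball x d" using y d(1) by (auto simp: dist_norm norm_minus_commute)
    then have yU: "y \<in> U" using d(2) by auto
    define H where "H t z = F z t - (\<Sum>b\<in>B. (z \<bullet> b) * g b x t)" for t z
    have bd: "norm (H t y - H t x) \<le> e * norm (y - x)" if t: "t \<in> {0..1}" for t
    proof (rule differentiable_bound[OF convex_ball _ _ yb])
      fix z assume z: "z \<in> ball x d"
      then have zU: "z \<in> U" and zX: "\<And>b. b \<in> B \<Longrightarrow> z \<in> X b" using d(2) by auto
      have "(H t has_derivative (\<lambda>v. (\<Sum>b\<in>B. (v \<bullet> b) * g b z t) - (\<Sum>b\<in>B. (v \<bullet> b) * g b x t))) (at z)"
        unfolding H_def
        by (intro has_derivative_diff der zU t bounded_linear_imp_has_derivative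
            bounded_linear_sum bounded_linear_mult_const bounded_linear_inner_left)
      then have "(H t has_derivative (\<lambda>v. \<Sum>b\<in>B. (v \<bullet> b) * (g b z t - g b x t))) (at z)"
        by (simp add: sum_subtractf right_diff_distrib)
      then show "(H t has_derivative (\<lambda>v. \<Sum>b\<in>B. (v \<bullet> b) * (g b z t - g b x t))) (at z within ball x d)"
        by (rule has_derivative_at_withinI)
      show "onorm (\<lambda>v. \<Sum>b\<in>B. (v \<bullet> b) * (g b z t - g b x t)) \<le> e"
      proof (rule onorm_bound)
        fix v
        have "norm (\<Sum>b\<in>B. (v \<bullet> b) * (g b z t - g b x t)) \<le> (\<Sum>b\<in>B. norm v * norm b * e')"
          unfolding real_norm_def
        proof (rule order_trans[OF sum_abs sum_mono])
          fix b assume "b \<in> B"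
          then show "\<bar>(v \<bullet> b) * (g b z t - g b x t)\<bar> \<le> norm v * norm b * e'"
            unfolding abs_mult using X(3)[OF _ zX zU t]
            by (intro mult_mono Cauchy_Schwarz_ineq2) auto
        qed
        also have "\<dots> = (S * e') * norm v"
          by (simp add: S_def sum_distrib_left sum_distrib_right mult_ac)
        also have "\<dots> \<le> e * norm v" using e' by (intro mult_right_mono) auto
        finally show "norm (\<Sum>b\<in>B. (v \<bullet> b) * (g b z t - g b x t)) \<le> e * norm v" .
      qed (use \<open>e > 0\<close> in auto)
    qed
    have cH: "continuous_on {0..1} (\<lambda>t. H t z)" if "z \<in> U" for z
      unfolding H_def by (intro continuous_intros cF cgx that x)
    have "((\<lambda>t. H t z) has_integral (integral {0..1} (F z) -
        (\<Sum>b\<in>B. (z \<bullet> b) * integral {0..1} (g b x)))) {0..1}" if "z \<in> U" for z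
      unfolding H_def
      by (intro has_integral_diff has_integral_sum has_integral_mult_right integrable_integral
          integrable_continuous_interval cF cgx that x frame_finite[OF B])
    from has_integral_diff[OF this[OF yU] this[OF x]]
    have "integral {0..1} (\<lambda>t. H t y - H t x) = integral {0..1} (F y) - integral {0..1} (F x) -
        (\<Sum>b\<in>B. ((y - x) \<bullet> b) * integral {0..1} (g b x))"
      by (intro integral_unique) (simp add: inner_diff_left left_diff_distrib sum_subtractf algebra_simps)
    moreover have "norm (integral {0..1} (\<lambda>t. H t y - H t x)) \<le> e * norm (y - x) * (1 - 0)"
      by (intro integral_bound continuous_intros cH yU x bd) auto
    ultimately show ?thesis by simp
  qed
  then show "\<exists>d>0. \<forall>y. norm (y - x) < d \<longrightarrow>
      norm (integral {0..1} (F y) - integral {0..1} (F x) -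
      (\<Sum>b\<in>B. ((y - x) \<bullet> b) * integral {0..1} (g b x))) \<le> e * norm (y - x)"
    using d(1) by blast
qed

lemma ray_in_ball:
  fixes c :: "'e::real_normed_vector"
  assumes "x \<in> ball c r" "t \<in> {0..1}"
  shows "c + t *\<^sub>R (x - c) \<in> ball c r"
proof -
  have "norm (t *\<^sub>R (x - c)) \<le> norm (x - c)"
    using assms(2) by (simp add: mult_left_le_one_le)
  then show ?thesis using assms(1) by (simp add: dist_norm norm_minus_commute)
qed

text \<open>The weight t^m closes the induction: differentiating in x brings out a factor t, so the
  derivatives are combinations of averages of the same kind, with m + 1 for m and partial
  derivatives of f for f.\<close>

lemma smooth_on_ray_average:
  fixes f :: "'e::real_inner \<Rightarrow> real" and B :: "'e set"
  assumes B: "frame B" and f: "smooth_on (ball c r) f"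
  shows "smooth_on (ball c r) (\<lambda>x. integral {0..1} (\<lambda>t. t ^ m * f (c + t *\<^sub>R (x - c))))"
proof -
  define I where "I m f x = integral {0..1} (\<lambda>t. t ^ m * f (c + t *\<^sub>R (x - c)))"
    for m and f :: "'e \<Rightarrow> real" and x
  have ray: "c + t *\<^sub>R (x - c) \<in> ball c r" if "x \<in> ball c r" "t \<in> {0..1}" for x t
    using ray_in_ball that by blast
  have cont: "continuous_on (ball c r \<times> {0..1}) (\<lambda>(y, t). t ^ m * f (c + t *\<^sub>R (y - c)))"
    if "smooth_on (ball c r) f" for f :: "'e \<Rightarrow> real" and m
    unfolding split_beta
    by (intro continuous_intros continuous_on_compose2[OF smooth_on_continuous_on[OF that]])
       (use ray in auto)
  have der: "(I m f has_derivative
      (\<lambda>v. \<Sum>b\<in>B. (v \<bullet> b) * I (Suc m) (\<lambda>x. frechet_derivative f (at x) b) x)) (at x)"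
    if f: "smooth_on (ball c r) f" and x: "x \<in> ball c r" for f :: "'e \<Rightarrow> real" and m x
    unfolding I_def
  proof (rule has_derivative_integral_frame[OF B open_ball x])
    fix y t assume yt: "y \<in> ball c r" "t \<in> {0..1::real}"
    define z where "z = c + t *\<^sub>R (y - c)"
    have d: "f differentiable (at z)"
      unfolding z_def using ray[OF yt] by (rule smooth_on_differentiable[OF f])
    have "((\<lambda>y. c + t *\<^sub>R (y - c)) has_derivative (\<lambda>v. t *\<^sub>R v)) (at y)"
      by (auto intro!: derivative_eq_intros)
    from has_derivative_compose[OF this, of f "frechet_derivative f (at z)"]
    have "((\<lambda>y. f (c + t *\<^sub>R (y - c))) has_derivative (\<lambda>v. frechet_derivative f (at z) (t *\<^sub>R v))) (at y)"
      using d unfolding z_def frechet_derivative_works by blast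
    then have "((\<lambda>y. t ^ m * f (c + t *\<^sub>R (y - c))) has_derivative
        (\<lambda>v. t ^ m * frechet_derivative f (at z) (t *\<^sub>R v))) (at y)"
      by (rule has_derivative_mult_right)
    moreover have "t ^ m * frechet_derivative f (at z) (t *\<^sub>R v) =
        (\<Sum>b\<in>B. (v \<bullet> b) * (t ^ Suc m * frechet_derivative f (at z) b))" for v
    proof -
      have "frechet_derivative f (at z) (t *\<^sub>R v) = t * (\<Sum>b\<in>B. (v \<bullet> b) * frechet_derivative f (at z) b)"
        using linear_frame_expand[OF B linear_frechet_derivative[OF d], of v]
        by (simp only: linear_scale[OF linear_frechet_derivative[OF d]] real_scaleR_def)
      then show ?thesis by (simp add: sum_distrib_left mult_ac)
    qed
    ultimately show "((\<lambda>y. t ^ m * f (c + t *\<^sub>R (y - c))) has_derivative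
       (\<lambda>v. \<Sum>b\<in>B. (v \<bullet> b) * (t ^ Suc m * frechet_derivative f (at (c + t *\<^sub>R (y - c))) b))) (at y)"
      by (simp add: z_def)
  next
    fix y assume "y \<in> ball c r"
    then show "continuous_on {0..1} (\<lambda>t. t ^ m * f (c + t *\<^sub>R (y - c)))"
      by (intro continuous_intros continuous_on_compose2[OF smooth_on_continuous_on[OF f]])
         (use ray in auto)
  next
    fix b
    show "continuous_on (ball c r \<times> {0..1})
        (\<lambda>(y, t). t ^ Suc m * frechet_derivative f (at (c + t *\<^sub>R (y - c))) b)"
      by (rule cont[OF smooth_on_frechet_derivative[OF f]])
  qed
  have "ck_on k (ball c r) (I m f)" if "smooth_on (ball c r) f" for f :: "'e \<Rightarrow> real" and k m
    using that
  proof (induction k arbitrary: m f)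
    case 0
    then show ?case
      using der[OF 0] by (auto intro!: continuous_at_imp_continuous_on has_derivative_continuous)
  next
    case (Suc k)
    have "ck_on k (ball c r) (\<lambda>x. \<Sum>b\<in>B. (v \<bullet> b) * I (Suc m) (\<lambda>x. frechet_derivative f (at x) b) x)"
      for v
      by (intro ck_on_sum ck_on_mult ck_on_const Suc.IH smooth_on_frechet_derivative Suc.prems open_ball)
    then have "ck_on k (ball c r) (\<lambda>x. frechet_derivative (I m f) (at x) v)" for v
      by (rule ck_on_cong[OF open_ball, rotated])
         (rule fun_cong[OF frechet_derivative_at[OF der[OF Suc.prems]]])
    then show ?case using differentiableI[OF der[OF Suc.prems]] by simp
  qed
  from this[OF f] have "\<forall>k. ck_on k (ball c r) (I m f)" by blast
  then show ?thesis unfolding smooth_on_def I_def .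
qed

text \<open>By the fundamental theorem of calculus, f x - f c is the integral over the segment from
  c to x of the derivative in direction x - c. Expanding this direction in the frame shows that
  \<open>g b\<close> is the average of the b-th partial derivative over the segment.\<close>

lemma Hadamard:
  fixes f :: "'e::real_inner \<Rightarrow> real" and B :: "'e set"
  assumes B: "frame B" and f: "smooth_on (ball c r) f"
  obtains g where "\<And>b. smooth_on (ball c r) (g b)"
    "\<And>b. g b c = frechet_derivative f (at c) b"
    "\<And>x. x \<in> ball c r \<Longrightarrow> f x = f c + (\<Sum>b\<in>B. ((x - c) \<bullet> b) * g b x)"
proof -
  define h where "h b x = frechet_derivative f (at x) b" for b x
  \<comment> \<open>The factor \<open>t ^ 0\<close> gives the integral the shape treated in
    \<open>smooth_on_ray_average\<close>.\<close>
  define g where "g b x = integral {0..1} (\<lambda>t. t ^ 0 * h b (c + t *\<^sub>R (x - c)))" for b x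
  have h: "smooth_on (ball c r) (h b)" for b
    unfolding h_def by (rule smooth_on_frechet_derivative[OF f])
  have 1: "smooth_on (ball c r) (g b)" for b
    unfolding g_def by (rule smooth_on_ray_average[OF B h])
  have 2: "g b c = frechet_derivative f (at c) b" for b
    by (simp add: g_def h_def)
  have 3: "f x = f c + (\<Sum>b\<in>B. ((x - c) \<bullet> b) * g b x)" if x: "x \<in> ball c r" for x
  proof -
    have ray: "c + t *\<^sub>R (x - c) \<in> ball c r" if "t \<in> {0..1}" for t
      using ray_in_ball x that by blast
    have "((\<lambda>t. \<Sum>b\<in>B. ((x - c) \<bullet> b) * h b (c + t *\<^sub>R (x - c))) has_integral
        (f (c + 1 *\<^sub>R (x - c)) - f (c + 0 *\<^sub>R (x - c)))) {0..1}"
    proof (rule fundamental_theorem_of_calculus)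
      fix t :: real assume t: "t \<in> {0..1}"
      define z where "z = c + t *\<^sub>R (x - c)"
      have d: "f differentiable (at z)"
        unfolding z_def using ray[OF t] by (rule smooth_on_differentiable[OF f])
      have "((\<lambda>t. c + t *\<^sub>R (x - c)) has_derivative (\<lambda>s. s *\<^sub>R (x - c))) (at t)"
        by (auto intro!: derivative_eq_intros)
      from has_derivative_compose[OF this, of f "frechet_derivative f (at z)"]
      have "((\<lambda>t. f (c + t *\<^sub>R (x - c))) has_derivative
          (\<lambda>s. frechet_derivative f (at z) (s *\<^sub>R (x - c)))) (at t)"
        using d unfolding z_def frechet_derivative_works by blast
      moreover have "frechet_derivative f (at z) (s *\<^sub>R (x - c)) =
          s *\<^sub>R (\<Sum>b\<in>B. ((x - c) \<bullet> b) * h b z)" for s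
        using linear_frame_expand[OF B linear_frechet_derivative[OF d], of "x - c"]
        by (simp only: linear_scale[OF linear_frechet_derivative[OF d]] real_scaleR_def h_def)
      ultimately have "((\<lambda>t. f (c + t *\<^sub>R (x - c))) has_vector_derivative
          (\<Sum>b\<in>B. ((x - c) \<bullet> b) * h b z)) (at t)"
        by (simp add: has_vector_derivative_def)
      then show "((\<lambda>t. f (c + t *\<^sub>R (x - c))) has_vector_derivative
          (\<Sum>b\<in>B. ((x - c) \<bullet> b) * h b (c + t *\<^sub>R (x - c)))) (at t within {0..1})"
        unfolding z_def by (rule has_vector_derivative_at_within)
    qed simp
    moreover have "((\<lambda>t. \<Sum>b\<in>B. ((x - c) \<bullet> b) * h b (c + t *\<^sub>R (x - c))) has_integral
        (\<Sum>b\<in>B. ((x - c) \<bullet> b) * g b x)) {0..1}"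
      unfolding g_def power_0 mult_1
      by (intro has_integral_sum has_integral_mult_right integrable_integral
          integrable_continuous_interval frame_finite[OF B]
          continuous_on_compose2[OF smooth_on_continuous_on[OF h]] continuous_intros)
         (use ray in auto)
    ultimately have "f x - f c = (\<Sum>b\<in>B. ((x - c) \<bullet> b) * g b x)"
      by (auto dest: has_integral_unique)
    then show ?thesis by simp
  qed
  show thesis by (rule that[OF 1 2 3])
qed


section \<open>Tangent vectors as derivations\<close>

lemma tangent_add: "D \<in> tangent_space A p \<Longrightarrow> smooth_fun A f \<Longrightarrow> smooth_fun A g \<Longrightarrow>
    D (\<lambda>x. f x + g x) = D f + D g"
  and tangent_cmult: "D \<in> tangent_space A p \<Longrightarrow> smooth_fun A f \<Longrightarrow> D (\<lambda>x. c * f x) = c * D f"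
  and tangent_mult: "D \<in> tangent_space A p \<Longrightarrow> smooth_fun A f \<Longrightarrow> smooth_fun A g \<Longrightarrow>
    D (\<lambda>x. f x * g x) = f p * D g + g p * D f"
  and tangent_not_smooth: "D \<in> tangent_space A p \<Longrightarrow> \<not> smooth_fun A f \<Longrightarrow> D f = 0"
  by (auto simp: tangent_space_def)

lemma tangentI:
  assumes "\<And>f g. smooth_fun A f \<Longrightarrow> smooth_fun A g \<Longrightarrow> D (\<lambda>x. f x + g x) = D f + D g"
    and "\<And>c f. smooth_fun A f \<Longrightarrow> D (\<lambda>x. c * f x) = c * D f"
    and "\<And>f g. smooth_fun A f \<Longrightarrow> smooth_fun A g \<Longrightarrow> D (\<lambda>x. f x * g x) = f p * D g + g p * D f"
    and "\<And>f. \<not> smooth_fun A f \<Longrightarrow> D f = 0"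
  shows "D \<in> tangent_space A p"
  using assms by (simp add: tangent_space_def)

lemma tangent_space_add:
  "v \<in> tangent_space A p \<Longrightarrow> w \<in> tangent_space A p \<Longrightarrow> (\<lambda>f. v f + w f) \<in> tangent_space A p"
  by (rule tangentI)
     (simp_all add: tangent_add tangent_cmult tangent_mult tangent_not_smooth algebra_simps)

lemma tangent_space_scale:
  "v \<in> tangent_space A p \<Longrightarrow> (\<lambda>f. c * v f) \<in> tangent_space A p"
  by (rule tangentI)
     (simp_all add: tangent_add tangent_cmult tangent_mult tangent_not_smooth algebra_simps)

lemma tangent_space_zero: "(\<lambda>f. 0) \<in> tangent_space A p"
  by (rule tangentI) simp_all

lemma tangent_space_sum:
  "(\<And>i. i \<in> I \<Longrightarrow> v i \<in> tangent_space A p) \<Longrightarrow> (\<lambda>f. \<Sum>i\<in>I. v i f) \<in> tangent_space A p"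
  by (induction I rule: infinite_finite_induct)
     (auto intro: tangent_space_zero tangent_space_add)

lemma cotangent_add: "\<alpha> \<in> cotangent_space A p \<Longrightarrow> v \<in> tangent_space A p \<Longrightarrow>
    w \<in> tangent_space A p \<Longrightarrow> \<alpha> (\<lambda>f. v f + w f) = \<alpha> v + \<alpha> w"
  and cotangent_scale: "\<alpha> \<in> cotangent_space A p \<Longrightarrow> v \<in> tangent_space A p \<Longrightarrow>
    \<alpha> (\<lambda>f. c * v f) = c * \<alpha> v"
  and cotangent_outside: "\<alpha> \<in> cotangent_space A p \<Longrightarrow> v \<notin> tangent_space A p \<Longrightarrow> \<alpha> v = 0"
  by (auto simp: cotangent_space_def)

lemma cotangentI:
  assumes "\<And>v w. v \<in> tangent_space A p \<Longrightarrow> w \<in> tangent_space A p \<Longrightarrow>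
      \<alpha> (\<lambda>f. v f + w f) = \<alpha> v + \<alpha> w"
    and "\<And>c v. v \<in> tangent_space A p \<Longrightarrow> \<alpha> (\<lambda>f. c * v f) = c * \<alpha> v"
    and "\<And>v. v \<notin> tangent_space A p \<Longrightarrow> \<alpha> v = 0"
  shows "\<alpha> \<in> cotangent_space A p"
  using assms by (simp add: cotangent_space_def)

lemma cotangent_diff:
  assumes "\<alpha> \<in> cotangent_space A p" "v \<in> tangent_space A p" "w \<in> tangent_space A p"
  shows "\<alpha> (\<lambda>f. v f - w f) = \<alpha> v - \<alpha> w"
  using cotangent_add[OF assms(1,2) tangent_space_scale[OF assms(3)], of "-1"]
    cotangent_scale[OF assms(1,3), of "-1"] by simp

lemma cotangent_null: "\<alpha> \<in> cotangent_space A p \<Longrightarrow> \<alpha> (\<lambda>f. 0) = 0"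
  using cotangent_scale[OF _ tangent_space_zero, of \<alpha> A p 0] by simp

lemma cotangent_sum:
  assumes "\<alpha> \<in> cotangent_space A p"
  shows "(\<And>i. i \<in> I \<Longrightarrow> v i \<in> tangent_space A p) \<Longrightarrow>
    \<alpha> (\<lambda>f. \<Sum>i\<in>I. v i f) = (\<Sum>i\<in>I. \<alpha> (v i))"
  by (induction I rule: infinite_finite_induct)
     (simp_all add: cotangent_null[OF assms] cotangent_add[OF assms] tangent_space_sum)

lemma cotangent_space_add:
  "\<alpha> \<in> cotangent_space A p \<Longrightarrow> \<beta> \<in> cotangent_space A p \<Longrightarrow> (\<lambda>v. \<alpha> v + \<beta> v) \<in> cotangent_space A p"
  by (rule cotangentI) (simp_all add: cotangent_add cotangent_scale cotangent_outside algebra_simps)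

lemma cotangent_space_scale:
  "\<alpha> \<in> cotangent_space A p \<Longrightarrow> (\<lambda>v. c * \<alpha> v) \<in> cotangent_space A p"
  by (rule cotangentI) (simp_all add: cotangent_add cotangent_scale cotangent_outside algebra_simps)

lemma cotangent_space_zero: "(\<lambda>v. 0) \<in> cotangent_space A p"
  by (rule cotangentI) simp_all

lemma cotangent_eqI:
  assumes "\<alpha> \<in> cotangent_space A p" "\<beta> \<in> cotangent_space A p"
    and "\<And>v. v \<in> tangent_space A p \<Longrightarrow> \<alpha> v = \<beta> v"
  shows "\<alpha> = \<beta>"
  using assms by (metis cotangent_outside ext)

lemma tangent_eqI:
  assumes "v \<in> tangent_space A p" "w \<in> tangent_space A p"
    and "\<And>f. smooth_fun A f \<Longrightarrow> v f = w f"
  shows "v = w"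
  using assms by (metis tangent_not_smooth ext)

definition differential :: "('m, 'e::real_inner) atlas \<Rightarrow> ('m \<Rightarrow> real) \<Rightarrow> 'm \<Rightarrow> 'm covec" where
  "differential A f p v = (if v \<in> tangent_space A p then v f else 0)"

lemma differential_cotangent: "differential A f p \<in> cotangent_space A p"
  by (rule cotangentI) (simp_all add: differential_def tangent_space_add tangent_space_scale)


section \<open>Charts, cutoffs and coordinate vectors\<close>

locale smooth_manifold =
  fixes A :: "('m::{t2_space, second_countable_topology}, 'e::real_inner) atlas"
    and B :: "'e set"
  assumes atlas: "smooth_atlas A" and frame: "frame B"
begin

lemma chart_open: "(U, \<psi>) \<in> A \<Longrightarrow> open U"
  and chart_image_open: "(U, \<psi>) \<in> A \<Longrightarrow> open (\<psi> ` U)"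
  and chart_homeomorphism: "(U, \<psi>) \<in> A \<Longrightarrow> homeomorphism U (\<psi> ` U) \<psi> (inv_into U \<psi>)"
  and chart_transition: "(U, \<psi>) \<in> A \<Longrightarrow> (V, \<theta>) \<in> A \<Longrightarrow>
    smooth_on (\<psi> ` (U \<inter> V)) (\<lambda>x. \<theta> (inv_into U \<psi> x))"
  using atlas unfolding smooth_atlas_def o_def by fast+

lemma chart_inv: "(U, \<psi>) \<in> A \<Longrightarrow> q \<in> U \<Longrightarrow> inv_into U \<psi> (\<psi> q) = q"
  using chart_homeomorphism by (metis homeomorphism_apply1)

lemma chart_at:
  obtains U \<psi> where "(U, \<psi>) \<in> A" "p \<in> U"
proof -
  have "p \<in> (\<Union>(U, \<psi>)\<in>A. U)" using atlas by (simp add: smooth_atlas_def)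
  then show thesis using that by auto
qed

lemma chart_open_image:
  assumes "(U, \<psi>) \<in> A" "open N" "N \<subseteq> U"
  shows "open (\<psi> ` N)"
proof -
  have "\<psi> ` N = \<psi> ` U \<inter> inv_into U \<psi> -` N"
    using assms(3) chart_inv[OF assms(1)] by (auto simp: image_iff)
  moreover have "continuous_on (\<psi> ` U) (inv_into U \<psi>)"
    using chart_homeomorphism[OF assms(1)] by (rule homeomorphism_cont2)
  ultimately show ?thesis
    using continuous_open_preimage chart_image_open[OF assms(1)] assms(2) by metis
qed

lemma smooth_funD:
  "smooth_fun A f \<Longrightarrow> (U, \<psi>) \<in> A \<Longrightarrow> smooth_on (\<psi> ` U) (\<lambda>x. f (inv_into U \<psi> x))"
  by (auto simp: smooth_fun_def o_def)

lemma smooth_funI: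
  "(\<And>U \<psi>. (U, \<psi>) \<in> A \<Longrightarrow> smooth_on (\<psi> ` U) (\<lambda>x. f (inv_into U \<psi> x))) \<Longrightarrow> smooth_fun A f"
  by (auto simp: smooth_fun_def o_def)

lemma smooth_fun_const [simp]: "smooth_fun A (\<lambda>q. c)"
  by (rule smooth_funI) simp

lemma smooth_fun_add: "smooth_fun A f \<Longrightarrow> smooth_fun A g \<Longrightarrow> smooth_fun A (\<lambda>q. f q + g q)"
  by (rule smooth_funI) (intro smooth_on_add chart_image_open smooth_funD)

lemma smooth_fun_mult: "smooth_fun A f \<Longrightarrow> smooth_fun A g \<Longrightarrow> smooth_fun A (\<lambda>q. f q * g q)"
  by (rule smooth_funI) (intro smooth_on_mult chart_image_open smooth_funD)

lemma smooth_fun_diff: "smooth_fun A f \<Longrightarrow> smooth_fun A g \<Longrightarrow> smooth_fun A (\<lambda>q. f q - g q)"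
  using smooth_fun_add[OF _ smooth_fun_mult[OF smooth_fun_const, of g "-1"], of f] by simp

lemma smooth_fun_sum:
  "(\<And>i. i \<in> I \<Longrightarrow> smooth_fun A (f i)) \<Longrightarrow> smooth_fun A (\<lambda>q. \<Sum>i\<in>I. f i q)"
  by (induction I rule: infinite_finite_induct) (auto intro: smooth_fun_add)

lemmas smooth_fun_intros =
  smooth_fun_const smooth_fun_add smooth_fun_diff smooth_fun_mult smooth_fun_sum

text \<open>The Leibniz rule for 1 = 1 * 1 gives D 1 = 2 * D 1; homogeneity does the rest.\<close>

lemma tangent_const: "D \<in> tangent_space A p \<Longrightarrow> D (\<lambda>q. c) = 0"
  using tangent_mult[of D A p "\<lambda>q. 1" "\<lambda>q. 1"] tangent_cmult[of D A p "\<lambda>q. 1" c] by simp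

lemma tangent_diff: "D \<in> tangent_space A p \<Longrightarrow> smooth_fun A f \<Longrightarrow> smooth_fun A g \<Longrightarrow>
    D (\<lambda>x. f x - g x) = D f - D g"
  using tangent_add[of D A p f "\<lambda>x. -1 * g x"] tangent_cmult[of D A p g "-1"]
    smooth_fun_mult[OF smooth_fun_const, of g "-1"] by simp

lemma tangent_sum:
  assumes "D \<in> tangent_space A p"
  shows "(\<And>i. i \<in> I \<Longrightarrow> smooth_fun A (f i)) \<Longrightarrow> D (\<lambda>x. \<Sum>i\<in>I. f i x) = (\<Sum>i\<in>I. D (f i))"
  by (induction I rule: infinite_finite_induct)
     (simp_all add: tangent_const[OF assms] tangent_add[OF assms] smooth_fun_sum)

definition extend :: "'m set \<Rightarrow> ('m \<Rightarrow> 'e) \<Rightarrow> ('e \<Rightarrow> real) \<Rightarrow> 'm \<Rightarrow> real" where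
  "extend U \<psi> h q = (if q \<in> U then h (\<psi> q) else 0)"

text \<open>The image of any chart is covered by two open sets: the part that the transition map
  \<open>T\<close> sends into W, where the function is h composed with \<open>T\<close>, and the
  complement of \<open>C\<close>, where it vanishes. The set \<open>C\<close> is compact, hence
  closed because the manifold is Hausdorff.\<close>

lemma smooth_fun_extend:
  assumes c: "(U, \<psi>) \<in> A" and K: "compact K" "K \<subseteq> W" and W: "open W" "W \<subseteq> \<psi> ` U"
    and h: "smooth_on W h" "\<And>x. x \<notin> K \<Longrightarrow> h x = 0"
  shows "smooth_fun A (extend U \<psi> h)"
proof (rule smooth_funI)
  fix V \<theta> assume c': "(V, \<theta>) \<in> A"
  define T where "T x = \<psi> (inv_into V \<theta> x)" for x
  define C where "C = inv_into U \<psi> ` K"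
  define S1 where "S1 = \<theta> ` (V \<inter> U) \<inter> T -` W"
  define S2 where "S2 = \<theta> ` (V - C)"
  have T: "smooth_on (\<theta> ` (V \<inter> U)) T" unfolding T_def by (rule chart_transition[OF c' c])
  have "compact C" unfolding C_def
    using K W(2) homeomorphism_cont2[OF chart_homeomorphism[OF c]]
    by (intro compact_continuous_image) (auto intro: continuous_on_subset)
  then have "closed C" by (rule compact_imp_closed)
  then have S2: "open S2" unfolding S2_def
    by (intro chart_open_image[OF c'] open_Diff chart_open[OF c']) auto
  have "open (\<theta> ` (V \<inter> U))"
    by (intro chart_open_image[OF c'] open_Int chart_open[OF c'] chart_open[OF c]) auto
  then have S1: "open S1" unfolding S1_def
    by (intro continuous_open_preimage W(1) smooth_on_continuous_on[OF T])
  have "smooth_on S1 (\<lambda>x. h (T x))"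
    by (rule smooth_on_compose[OF frame S1 smooth_on_subset[OF T] _ h(1)]) (auto simp: S1_def)
  then have 1: "smooth_on S1 (\<lambda>x. extend U \<psi> h (inv_into V \<theta> x))"
    by (rule smooth_on_cong[OF S1, rotated])
       (auto simp: S1_def extend_def T_def chart_inv[OF c'])
  have zero: "extend U \<psi> h q = 0" if "q \<notin> C" for q
  proof (cases "q \<in> U")
    case True
    then have "\<psi> q \<notin> K" using that chart_inv[OF c True] by (auto simp: C_def image_iff)
    then show ?thesis by (simp add: extend_def h(2))
  qed (simp add: extend_def)
  have 2: "smooth_on S2 (\<lambda>x. extend U \<psi> h (inv_into V \<theta> x))"
    by (rule smooth_on_cong[OF S2 _ smooth_on_const[of _ 0]])
       (auto simp: S2_def chart_inv[OF c'] zero)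
  have "\<theta> ` V = S1 \<union> S2"
  proof
    show "\<theta> ` V \<subseteq> S1 \<union> S2"
    proof
      fix x assume "x \<in> \<theta> ` V"
      then obtain q where q: "q \<in> V" "x = \<theta> q" by blast
      show "x \<in> S1 \<union> S2"
      proof (cases "q \<in> C")
        case True
        then obtain k where k: "k \<in> K" "q = inv_into U \<psi> k" by (auto simp: C_def)
        with K W have "k \<in> \<psi> ` U" by auto
        then have "q \<in> U" "\<psi> q = k" using k by (auto simp: inv_into_into f_inv_into_f)
        then have "x \<in> S1" using q k K by (auto simp: S1_def T_def chart_inv[OF c'])
        then show ?thesis ..
      qed (use q in \<open>auto simp: S2_def\<close>)
    qed
  qed (auto simp: S1_def S2_def)
  then show "smooth_on (\<theta> ` V) (\<lambda>x. extend U \<psi> h (inv_into V \<theta> x))"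
    using smooth_on_Un[OF S1 S2 1 2] by simp
qed

text \<open>The support lies in the ball of half the radius, so that a function smooth on the full
  ball, multiplied by the cutoff, extends by 0 to the manifold. The value 1 is prescribed at the
  centre and not near it; derivatives of the cutoff therefore appear in the formulas below and have
  to cancel.\<close>

definition cutoff :: "'m set \<Rightarrow> ('m \<Rightarrow> 'e) \<Rightarrow> 'm \<Rightarrow> real \<Rightarrow> ('e \<Rightarrow> real) \<Rightarrow> bool" where
  "cutoff U \<psi> p r \<phi> \<longleftrightarrow> (U, \<psi>) \<in> A \<and> p \<in> U \<and> 0 < r \<and> ball (\<psi> p) r \<subseteq> \<psi> ` U \<and>
    smooth_on UNIV \<phi> \<and> \<phi> (\<psi> p) = 1 \<and> (\<forall>x. x \<notin> ball (\<psi> p) (r / 2) \<longrightarrow> \<phi> x = 0)"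

lemma cutoff_exists:
  assumes c: "(U, \<psi>) \<in> A" and p: "p \<in> U"
  obtains r \<phi> where "cutoff U \<psi> p r \<phi>"
proof -
  obtain r where r: "r > 0" "ball (\<psi> p) r \<subseteq> \<psi> ` U"
    using chart_image_open[OF c] p by (meson imageI openE)
  obtain \<phi> :: "'e \<Rightarrow> real" where "smooth_on UNIV \<phi>" "\<phi> (\<psi> p) = 1" "\<And>x. x \<notin> ball (\<psi> p) (r / 2) \<Longrightarrow> \<phi> x = 0"
    by (rule bump_exists[OF frame half_gt_zero[OF r(1)], of "\<psi> p"]) (rule that)
  then show thesis using that[of r \<phi>] c p r by (simp add: cutoff_def)
qed

lemma cutoff_smooth_fun:
  assumes "cutoff U \<psi> p r \<phi>" "smooth_on (ball (\<psi> p) r) g"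
  shows "smooth_fun A (extend U \<psi> (\<lambda>x. \<phi> x * g x))"
proof (rule smooth_fun_extend[where K = "cball (\<psi> p) (r / 2)" and W = "ball (\<psi> p) r"])
  show "(U, \<psi>) \<in> A" "ball (\<psi> p) r \<subseteq> \<psi> ` U" using assms(1) by (auto simp: cutoff_def)
  show "compact (cball (\<psi> p) (r / 2))" by (rule compact_cball_frame[OF frame])
  show "cball (\<psi> p) (r / 2) \<subseteq> ball (\<psi> p) r" using assms(1) by (auto simp: cutoff_def)
  show "open (ball (\<psi> p) r)" by simp
  show "smooth_on (ball (\<psi> p) r) (\<lambda>x. \<phi> x * g x)"
    using assms by (intro smooth_on_mult) (auto simp: cutoff_def intro: smooth_on_subset)
  show "\<phi> x * g x = 0" if "x \<notin> cball (\<psi> p) (r / 2)" for x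
    using assms(1) that by (auto simp: cutoff_def)
qed

definition chart_vector :: "'m set \<Rightarrow> ('m \<Rightarrow> 'e) \<Rightarrow> 'm \<Rightarrow> 'e \<Rightarrow> 'm tvec" where
  "chart_vector U \<psi> q w f =
    (if smooth_fun A f then frechet_derivative (\<lambda>x. f (inv_into U \<psi> x)) (at (\<psi> q)) w else 0)"

lemma chart_differentiable:
  assumes "(U, \<psi>) \<in> A" "q \<in> U" "smooth_fun A f"
  shows "(\<lambda>x. f (inv_into U \<psi> x)) differentiable (at (\<psi> q))"
  using smooth_on_differentiable[OF smooth_funD[OF assms(3,1)]] assms(2) by blast

lemma chart_vector_tangent:
  assumes c: "(U, \<psi>) \<in> A" and q: "q \<in> U"
  shows "chart_vector U \<psi> q w \<in> tangent_space A q"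
proof (rule tangentI)
  fix f g assume f: "smooth_fun A f" and g: "smooth_fun A g"
  note d = chart_differentiable[OF c q f, unfolded frechet_derivative_works]
    chart_differentiable[OF c q g, unfolded frechet_derivative_works]
  show "chart_vector U \<psi> q w (\<lambda>x. f x + g x) = chart_vector U \<psi> q w f + chart_vector U \<psi> q w g"
    using f g smooth_fun_add[OF f g] fun_cong[OF frechet_derivative_at[OF has_derivative_add[OF d]], of w]
    by (simp add: chart_vector_def)
  show "chart_vector U \<psi> q w (\<lambda>x. f x * g x) =
      f q * chart_vector U \<psi> q w g + g q * chart_vector U \<psi> q w f"
    using f g smooth_fun_mult[OF f g]
      frechet_derivative_mult[OF chart_differentiable[OF c q f] chart_differentiable[OF c q g], of w]
    by (simp add: chart_vector_def chart_inv[OF c q] algebra_simps)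
next
  fix a f assume f: "smooth_fun A f"
  note d = chart_differentiable[OF c q f, unfolded frechet_derivative_works]
  show "chart_vector U \<psi> q w (\<lambda>x. a * f x) = a * chart_vector U \<psi> q w f"
    using f smooth_fun_mult[OF smooth_fun_const f, of a]
      fun_cong[OF frechet_derivative_at[OF has_derivative_mult_right[OF d]], of a w]
    by (simp add: chart_vector_def)
qed (simp add: chart_vector_def)

lemma chart_vector_expand:
  assumes "(U, \<psi>) \<in> A" "q \<in> U"
  shows "chart_vector U \<psi> q w f = (\<Sum>b\<in>B. (w \<bullet> b) * chart_vector U \<psi> q b f)"
proof (cases "smooth_fun A f")
  case True
  show ?thesis
    using linear_frame_expand[OF frame
        linear_frechet_derivative[OF chart_differentiable[OF assms True]], of w] True
    by (simp add: chart_vector_def)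
qed (simp add: chart_vector_def)

text \<open>Subtracting the centre makes these coordinates vanish at p, so that the Leibniz rule at
  p keeps only the term in which they are differentiated.\<close>

definition coord :: "'m set \<Rightarrow> ('m \<Rightarrow> 'e) \<Rightarrow> 'm \<Rightarrow> ('e \<Rightarrow> real) \<Rightarrow> 'e \<Rightarrow> 'm \<Rightarrow> real" where
  "coord U \<psi> p \<phi> b = extend U \<psi> (\<lambda>x. \<phi> x * ((x - \<psi> p) \<bullet> b))"

definition chart_field ::
    "'m set \<Rightarrow> ('m \<Rightarrow> 'e) \<Rightarrow> ('e \<Rightarrow> real) \<Rightarrow> 'e \<Rightarrow> 'm \<Rightarrow> 'm tvec" where
  "chart_field U \<psi> \<phi> w q f = (if q \<in> U then \<phi> (\<psi> q) * chart_vector U \<psi> q w f else 0)"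

lemma smooth_on_centred: "smooth_on S (\<lambda>x. (x - c) \<bullet> b)" if "open S" for S :: "'e set"
  using smooth_on_add[OF that smooth_on_inner_left[of S b] smooth_on_const[of S "- (c \<bullet> b)"]]
  by (simp add: inner_diff_left)

lemma coord_smooth: "cutoff U \<psi> p r \<phi> \<Longrightarrow> smooth_fun A (coord U \<psi> p \<phi> b)"
  unfolding coord_def by (intro cutoff_smooth_fun smooth_on_centred) auto

lemma cutoff_smooth: "cutoff U \<psi> p r \<phi> \<Longrightarrow> smooth_fun A (extend U \<psi> \<phi>)"
  using cutoff_smooth_fun[of U \<psi> p r \<phi> "\<lambda>x. 1"] by simp

lemma chart_vector_extend:
  assumes c: "(U, \<psi>) \<in> A" and q: "q \<in> U" and h: "smooth_fun A (extend U \<psi> h)"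
  shows "h differentiable (at (\<psi> q))"
    and "chart_vector U \<psi> q w (extend U \<psi> h) = frechet_derivative h (at (\<psi> q)) w"
proof -
  note d = chart_differentiable[OF c q h]
  have eq: "extend U \<psi> h (inv_into U \<psi> x) = h x" if "x \<in> \<psi> ` U" for x
    using that by (simp add: extend_def inv_into_into f_inv_into_f)
  have "((\<lambda>x. extend U \<psi> h (inv_into U \<psi> x)) has_derivative
      frechet_derivative (\<lambda>x. extend U \<psi> h (inv_into U \<psi> x)) (at (\<psi> q))) (at (\<psi> q))"
    using d by (simp add: frechet_derivative_works)
  from has_derivative_transform_within_open[OF this chart_image_open[OF c] _ eq]
  have "(h has_derivative
      frechet_derivative (\<lambda>x. extend U \<psi> h (inv_into U \<psi> x)) (at (\<psi> q))) (at (\<psi> q))"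
    using q by blast
  then show "h differentiable (at (\<psi> q))"
    "chart_vector U \<psi> q w (extend U \<psi> h) = frechet_derivative h (at (\<psi> q)) w"
    using fun_cong[OF frechet_derivative_at] h by (auto simp: chart_vector_def intro: differentiableI)
qed

text \<open>At the centre the second term vanishes and the component of w along b is left. Away from
  the centre, \<open>vector_field_frame_expansion\<close> eliminates that term.\<close>

lemma chart_vector_coord:
  assumes cut: "cutoff U \<psi> p r \<phi>" and q: "q \<in> U"
  shows "chart_vector U \<psi> q w (coord U \<psi> p \<phi> b) =
    \<phi> (\<psi> q) * (w \<bullet> b) + chart_vector U \<psi> q w (extend U \<psi> \<phi>) * ((\<psi> q - \<psi> p) \<bullet> b)"
proof -
  have c: "(U, \<psi>) \<in> A" using cut by (simp add: cutoff_def)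
  have \<phi>: "\<phi> differentiable (at (\<psi> q))"
    using chart_vector_extend(1)[OF c q cutoff_smooth[OF cut]] .
  have l: "((\<lambda>x. (x - \<psi> p) \<bullet> b) has_derivative (\<lambda>v. v \<bullet> b)) (at (\<psi> q))"
    by (auto intro!: derivative_eq_intros)
  then have "(\<lambda>x. (x - \<psi> p) \<bullet> b) differentiable (at (\<psi> q))"
    by (rule differentiableI)
  from frechet_derivative_mult[OF \<phi> this, of w] show ?thesis
    unfolding coord_def chart_vector_extend(2)[OF c q coord_smooth[OF cut, unfolded coord_def]]
      chart_vector_extend(2)[OF c q cutoff_smooth[OF cut]]
    using fun_cong[OF frechet_derivative_at[OF l], of w] by simp
qed

text \<open>Hadamard's lemma turns the action of a derivation into that of a directional derivative.\<close>

lemma tangent_is_chart_vector: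
  assumes c: "(U, \<psi>) \<in> A" and p: "p \<in> U" and v: "v \<in> tangent_space A p"
  obtains w where "v = chart_vector U \<psi> p w"
proof -
  obtain r \<phi> where cut: "cutoff U \<psi> p r \<phi>" using cutoff_exists[OF c p] by blast
  define \<Phi> where "\<Phi> = extend U \<psi> \<phi>"
  define y where "y = coord U \<psi> p \<phi>"
  have \<Phi>: "smooth_fun A \<Phi>" "\<Phi> p = 1" and y: "\<And>b. smooth_fun A (y b)" "\<And>b. y b p = 0"
    using cutoff_smooth[OF cut] coord_smooth[OF cut] cut p
    by (auto simp: \<Phi>_def y_def extend_def coord_def cutoff_def)
  \<comment> \<open>By \<open>chart_vector_coord\<close> at p, the component of w along b has to be
    \<open>v (y b)\<close>.\<close>
  define w where "w = (\<Sum>b\<in>B. v (y b) *\<^sub>R b)"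
  have "v f = chart_vector U \<psi> p w f" if f: "smooth_fun A f" for f
  proof -
    define F where "F = (\<lambda>x. f (inv_into U \<psi> x))"
    have Fs: "smooth_on (ball (\<psi> p) r) F"
      using smooth_funD[OF f c] cut by (auto simp: F_def cutoff_def intro: smooth_on_subset)
    obtain g where g: "\<And>b. smooth_on (ball (\<psi> p) r) (g b)"
      "\<And>b. g b (\<psi> p) = frechet_derivative F (at (\<psi> p)) b"
      "\<And>x. x \<in> ball (\<psi> p) r \<Longrightarrow> F x = F (\<psi> p) + (\<Sum>b\<in>B. ((x - \<psi> p) \<bullet> b) * g b x)"
      using Hadamard[OF frame Fs] by blast
    define G where "G b = extend U \<psi> (\<lambda>x. \<phi> x * g b x)" for b
    have G: "smooth_fun A (G b)" "G b p = chart_vector U \<psi> p b f" for b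
      using cutoff_smooth_fun[OF cut g(1)] cut p f g(2)
      by (auto simp: G_def extend_def cutoff_def chart_vector_def F_def)
    have "\<Phi> q * \<Phi> q * f q = f p * (\<Phi> q * \<Phi> q) + (\<Sum>b\<in>B. y b q * G b q)" for q
    proof (cases "q \<in> U \<and> \<psi> q \<in> ball (\<psi> p) r")
      case True
      have "f q = f p + (\<Sum>b\<in>B. ((\<psi> q - \<psi> p) \<bullet> b) * g b (\<psi> q))"
        using g(3)[of "\<psi> q"] True p by (simp add: F_def chart_inv[OF c])
      then show ?thesis using True
        by (simp add: \<Phi>_def y_def G_def extend_def coord_def sum_distrib_left algebra_simps)
    next
      case False
      then have "\<Phi> q = 0" "y b q = 0" for b
        using cut by (auto simp: \<Phi>_def y_def extend_def coord_def cutoff_def)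
      then show ?thesis by simp
    qed
    then have eq: "(\<lambda>q. \<Phi> q * \<Phi> q * f q) = (\<lambda>q. f p * (\<Phi> q * \<Phi> q) + (\<Sum>b\<in>B. y b q * G b q))"
      by (rule ext)
    \<comment> \<open>Now v is applied to both sides. The derivatives of the squared cutoff cancel,
      and since \<open>y b\<close> vanishes at p, the product of \<open>y b\<close> and
      \<open>G b\<close> contributes \<open>v (y b)\<close> times the b-th partial derivative of
      f.\<close>
    have "v (\<lambda>q. \<Phi> q * \<Phi> q * f q) = v f + f p * (2 * v \<Phi>)"
      by (simp add: tangent_mult[OF v smooth_fun_mult[OF \<Phi>(1) \<Phi>(1)] f] tangent_mult[OF v \<Phi>(1) \<Phi>(1)] \<Phi>(2))
    moreover have "v (\<lambda>q. f p * (\<Phi> q * \<Phi> q) + (\<Sum>b\<in>B. y b q * G b q)) =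
        v (\<lambda>q. f p * (\<Phi> q * \<Phi> q)) + v (\<lambda>q. \<Sum>b\<in>B. y b q * G b q)"
      using \<Phi> y G by (intro tangent_add[OF v] smooth_fun_intros) auto
    moreover have "v (\<lambda>q. f p * (\<Phi> q * \<Phi> q)) = f p * (2 * v \<Phi>)"
      using tangent_cmult[OF v smooth_fun_mult[OF \<Phi>(1) \<Phi>(1)], of "f p"]
      by (simp add: tangent_mult[OF v] \<Phi>)
    moreover have "v (\<lambda>q. \<Sum>b\<in>B. y b q * G b q) = (\<Sum>b\<in>B. v (y b) * chart_vector U \<psi> p b f)"
      by (subst tangent_sum[OF v])
         (auto intro!: smooth_fun_mult sum.cong simp: y G tangent_mult[OF v y(1) G(1)])
    ultimately have "v f = (\<Sum>b\<in>B. v (y b) * chart_vector U \<psi> p b f)"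
      unfolding eq by simp
    also have "\<dots> = frechet_derivative F (at (\<psi> p)) w"
      using linear_frechet_derivative[OF chart_differentiable[OF c p f], folded F_def]
      by (simp add: w_def linear_sum linear_scale chart_vector_def f F_def[symmetric])
    finally show ?thesis using f by (simp add: chart_vector_def F_def)
  qed
  then have "v = chart_vector U \<psi> p w"
    by (rule tangent_eqI[OF v chart_vector_tangent[OF c p]])
  then show thesis using that by blast
qed


section \<open>Vector fields and differential forms\<close>

lemma vector_field_tangent: "vector_field A X \<Longrightarrow> X p \<in> tangent_space A p"
  by (simp add: vector_field_def)

lemma vector_field_smooth: "vector_field A X \<Longrightarrow> smooth_fun A (\<lambda>q. X q f)"
  by (cases "smooth_fun A f")
     (auto simp: vector_field_def tangent_not_smooth[OF vector_field_tangent])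

lemma vector_fieldI:
  "(\<And>p. X p \<in> tangent_space A p) \<Longrightarrow> (\<And>f. smooth_fun A f \<Longrightarrow> smooth_fun A (\<lambda>q. X q f)) \<Longrightarrow>
    vector_field A X"
  by (simp add: vector_field_def)

lemma vector_field_zero: "vector_field A (\<lambda>q f. 0)"
  by (simp add: vector_fieldI tangent_space_zero)

lemma vector_field_add:
  "vector_field A X \<Longrightarrow> vector_field A Y \<Longrightarrow> vector_field A (\<lambda>q f. X q f + Y q f)"
  by (rule vector_fieldI) (simp_all add: tangent_space_add smooth_fun_add vector_field_smooth vector_field_tangent)

lemma vector_field_scale:
  "smooth_fun A h \<Longrightarrow> vector_field A X \<Longrightarrow> vector_field A (\<lambda>q f. h q * X q f)"
  by (rule vector_fieldI) (simp_all add: tangent_space_scale smooth_fun_mult vector_field_smooth vector_field_tangent)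

lemma vector_field_sum:
  "(\<And>i. i \<in> I \<Longrightarrow> vector_field A (X i)) \<Longrightarrow> vector_field A (\<lambda>q f. \<Sum>i\<in>I. X i q f)"
  by (induction I rule: infinite_finite_induct) (auto intro: vector_field_zero vector_field_add)

text \<open>In the Leibniz rule the mixed terms X f * Y g + X g * Y f are symmetric in X and Y, so
  they cancel in the difference.\<close>

lemma vector_field_bracket:
  assumes X: "vector_field A X" and Y: "vector_field A Y"
  shows "vector_field A (lie_bracket X Y)"
proof (rule vector_fieldI)
  fix p
  note XT = vector_field_tangent[OF X] and YT = vector_field_tangent[OF Y]
  note Xs = vector_field_smooth[OF X] and Ys = vector_field_smooth[OF Y]
  show "lie_bracket X Y p \<in> tangent_space A p"
  proof (rule tangentI)
    fix f g assume f: "smooth_fun A f" and g: "smooth_fun A g"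
    show "lie_bracket X Y p (\<lambda>x. f x + g x) = lie_bracket X Y p f + lie_bracket X Y p g"
      by (simp add: lie_bracket_def tangent_add[OF XT] tangent_add[OF YT] f g Xs Ys)
    show "lie_bracket X Y p (\<lambda>x. f x * g x) = f p * lie_bracket X Y p g + g p * lie_bracket X Y p f"
      by (simp add: lie_bracket_def tangent_mult[OF XT] tangent_mult[OF YT] f g Xs Ys
          tangent_add[OF XT] tangent_add[OF YT] smooth_fun_mult algebra_simps)
  next
    fix c f assume f: "smooth_fun A f"
    show "lie_bracket X Y p (\<lambda>x. c * f x) = c * lie_bracket X Y p f"
      by (simp add: lie_bracket_def tangent_cmult[OF XT] tangent_cmult[OF YT] f Xs Ys algebra_simps)
  next
    \<comment> \<open>The inner functions take the default value 0 everywhere, and derivations kill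
      constants.\<close>
    fix f assume "\<not> smooth_fun A f"
    then show "lie_bracket X Y p f = 0"
      by (simp add: lie_bracket_def tangent_not_smooth[OF XT] tangent_not_smooth[OF YT]
          tangent_const[OF XT] tangent_const[OF YT])
  qed
next
  fix f
  show "smooth_fun A (\<lambda>q. lie_bracket X Y q f)"
    unfolding lie_bracket_def by (intro smooth_fun_diff vector_field_smooth X Y)
qed

lemma lie_bracket_add_left:
  assumes "vector_field A X" "vector_field A X'" "vector_field A Y"
  shows "lie_bracket (\<lambda>q f. X q f + X' q f) Y p = (\<lambda>f. lie_bracket X Y p f + lie_bracket X' Y p f)"
  by (rule ext)
    (simp add: lie_bracket_def tangent_add[OF vector_field_tangent[OF assms(3)]]
      vector_field_smooth assms)

text \<open>The term with Y h, the failure of the bracket to be linear over functions, becomes the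
  vector part of \<open>anomaly\<close>.\<close>

lemma lie_bracket_scale_left:
  assumes h: "smooth_fun A h" and X: "vector_field A X" and Y: "vector_field A Y"
  shows "lie_bracket (\<lambda>q f. h q * X q f) Y p = (\<lambda>f. h p * lie_bracket X Y p f - Y p h * X p f)"
  by (rule ext)
    (simp add: lie_bracket_def tangent_mult[OF vector_field_tangent[OF Y] h] vector_field_smooth X
      algebra_simps)

lemma lie_bracket_swap: "lie_bracket Y X p = (\<lambda>f. -1 * lie_bracket X Y p f)"
  by (simp add: lie_bracket_def fun_eq_iff)

lemma chart_field_vector_field:
  assumes cut: "cutoff U \<psi> p r \<phi>"
  shows "vector_field A (chart_field U \<psi> \<phi> w)"
proof (rule vector_fieldI)
  have c: "(U, \<psi>) \<in> A" using cut by (simp add: cutoff_def)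
  show "chart_field U \<psi> \<phi> w q \<in> tangent_space A q" for q
  proof (cases "q \<in> U")
    case True
    then have "chart_field U \<psi> \<phi> w q = (\<lambda>f. \<phi> (\<psi> q) * chart_vector U \<psi> q w f)"
      by (simp add: chart_field_def fun_eq_iff)
    then show ?thesis using tangent_space_scale[OF chart_vector_tangent[OF c True]] by simp
  next
    case False
    then have "chart_field U \<psi> \<phi> w q = (\<lambda>f. 0)" by (simp add: chart_field_def fun_eq_iff)
    then show ?thesis by (simp add: tangent_space_zero)
  qed
  fix f assume f: "smooth_fun A f"
  have "smooth_on (ball (\<psi> p) r) (\<lambda>x. frechet_derivative (\<lambda>x. f (inv_into U \<psi> x)) (at x) w)"
    using smooth_on_subset[OF smooth_on_frechet_derivative[OF smooth_funD[OF f c]]] cut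
    by (simp add: cutoff_def)
  from cutoff_smooth_fun[OF cut this]
  show "smooth_fun A (\<lambda>q. chart_field U \<psi> \<phi> w q f)"
    by (rule back_subst[of "smooth_fun A"])
       (auto simp: extend_def chart_field_def chart_vector_def f)
qed

lemma tangent_extends:
  assumes "v \<in> tangent_space A p"
  obtains X where "vector_field A X" "X p = v"
proof -
  obtain U \<psi> where c: "(U, \<psi>) \<in> A" "p \<in> U" using chart_at by blast
  obtain r \<phi> where cut: "cutoff U \<psi> p r \<phi>" using cutoff_exists[OF c] by blast
  obtain w where "v = chart_vector U \<psi> p w" using tangent_is_chart_vector[OF c assms] by blast
  moreover have "chart_field U \<psi> \<phi> w p = chart_vector U \<psi> p w"
    using cut by (simp add: chart_field_def cutoff_def fun_eq_iff)
  ultimately show thesis using that[of "chart_field U \<psi> \<phi> w"] chart_field_vector_field[OF cut] by simp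
qed

lemma differential_one_form:
  assumes "smooth_fun A f"
  shows "one_form A (differential A f)"
  using assms
  by (auto simp: one_form_def differential_cotangent differential_def vector_field_tangent vector_field_smooth)

text \<open>At p the differential of the b-th cut-off coordinate sends the chart vector of w to
  \<open>w \<bullet> b\<close>. Combining these coordinates with the values of \<alpha> on the chart
  vectors of the frame gives f. Covectors thereby extend to one-forms, even exact ones.\<close>

lemma cotangent_is_differential:
  assumes \<alpha>: "\<alpha> \<in> cotangent_space A p"
  obtains f where "smooth_fun A f" "\<alpha> = differential A f p"
proof -
  obtain U \<psi> where c: "(U, \<psi>) \<in> A" "p \<in> U" using chart_at by blast
  obtain r \<phi> where cut: "cutoff U \<psi> p r \<phi>" using cutoff_exists[OF c] by blast
  define a where "a b = \<alpha> (chart_vector U \<psi> p b)" for b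
  define f where "f q = (\<Sum>b\<in>B. a b * coord U \<psi> p \<phi> b q)" for q
  have s: "smooth_fun A (coord U \<psi> p \<phi> b)" for b by (rule coord_smooth[OF cut])
  have f: "smooth_fun A f" unfolding f_def by (intro smooth_fun_intros s)
  have "\<alpha> v = differential A f p v" if v: "v \<in> tangent_space A p" for v
  proof -
    obtain w where w: "v = chart_vector U \<psi> p w" using tangent_is_chart_vector[OF c v] by blast
    note T = chart_vector_tangent[OF c]
    have "v f = (\<Sum>b\<in>B. a b * v (coord U \<psi> p \<phi> b))"
      unfolding f_def using s
      by (simp add: tangent_sum[OF v] tangent_cmult[OF v] smooth_fun_mult)
    also have "\<dots> = (\<Sum>b\<in>B. (w \<bullet> b) * a b)"
      using cut by (intro sum.cong) (simp_all add: w chart_vector_coord[OF cut c(2)] cutoff_def)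
    also have "\<dots> = \<alpha> (\<lambda>f. \<Sum>b\<in>B. (w \<bullet> b) * chart_vector U \<psi> p b f)"
      by (simp add: cotangent_sum[OF \<alpha>] cotangent_scale[OF \<alpha>] tangent_space_scale T a_def)
    also have "(\<lambda>f. \<Sum>b\<in>B. (w \<bullet> b) * chart_vector U \<psi> p b f) = v"
      by (rule ext) (simp add: w flip: chart_vector_expand[OF c])
    finally show ?thesis using v by (simp add: differential_def)
  qed
  then have "\<alpha> = differential A f p"
    by (rule cotangent_eqI[OF \<alpha> differential_cotangent])
  then show thesis using that f by blast
qed

section \<open>Operators linear over functions see only the value at the point\<close>

text \<open>The expansion in a chart, times the cube of the cutoff: two factors make the
  coefficients globally smooth, the third one makes the frame fields \<open>E b\<close> global. The
  functions \<open>y b\<close> are handed out because they show that the coefficients vanish at p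
  whenever X does.\<close>

lemma vector_field_frame_expansion:
  obtains \<Phi> E y where "smooth_fun A \<Phi>" "\<Phi> p = (1::real)" "\<And>b. vector_field A (E b)"
    "\<And>X. vector_field A X \<Longrightarrow> \<exists>a. (\<forall>b. smooth_fun A (a b)) \<and> (\<forall>b. a b p = X p (y b)) \<and>
      (\<forall>q f. \<Phi> q ^ 3 * X q f = (\<Sum>b\<in>B. a b q * E b q f))"
proof -
  obtain U \<psi> where c: "(U, \<psi>) \<in> A" "p \<in> U" using chart_at by blast
  obtain r \<phi> where cut: "cutoff U \<psi> p r \<phi>" using cutoff_exists[OF c] by blast
  define \<Phi> where "\<Phi> = extend U \<psi> \<phi>"
  define y where "y = coord U \<psi> p \<phi>"
  define E where "E = chart_field U \<psi> \<phi>"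
  have \<Phi>: "smooth_fun A \<Phi>" "\<Phi> p = 1" and y: "smooth_fun A (y b)" "y b p = 0" for b
    using cutoff_smooth[OF cut] coord_smooth[OF cut] cut
    by (auto simp: \<Phi>_def y_def extend_def coord_def cutoff_def)
  have E: "vector_field A (E b)" for b unfolding E_def by (rule chart_field_vector_field[OF cut])
  have ex: "\<exists>a. (\<forall>b. smooth_fun A (a b)) \<and> (\<forall>b. a b p = X p (y b)) \<and>
      (\<forall>q f. \<Phi> q ^ 3 * X q f = (\<Sum>b\<in>B. a b q * E b q f))" if X: "vector_field A X" for X
  proof -
    \<comment> \<open>This combination cancels the derivative of the cutoff in
      \<open>chart_vector_coord\<close>; what remains is the squared cutoff times
      \<open>w \<bullet> b\<close>.\<close>
    define a where "a b q = \<Phi> q * X q (y b) - y b q * X q \<Phi>" for b q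
    have "\<Phi> q ^ 3 * X q f = (\<Sum>b\<in>B. a b q * E b q f)" for q f
    proof (cases "q \<in> U")
      case True
      obtain w where w: "X q = chart_vector U \<psi> q w"
        using tangent_is_chart_vector[OF c(1) True vector_field_tangent[OF X]] by blast
      have a: "a b q = \<phi> (\<psi> q) ^ 2 * (w \<bullet> b)" for b
        unfolding a_def w y_def chart_vector_coord[OF cut True]
        using True by (simp add: \<Phi>_def coord_def extend_def power2_eq_square algebra_simps)
      have "(\<Sum>b\<in>B. a b q * E b q f) = \<phi> (\<psi> q) ^ 3 * (\<Sum>b\<in>B. (w \<bullet> b) * chart_vector U \<psi> q b f)"
        using True by (simp add: a E_def chart_field_def sum_distrib_left
            power2_eq_square power3_eq_cube mult_ac)
      then show ?thesis
        using True by (simp add: w \<Phi>_def extend_def flip: chart_vector_expand[OF c(1) True])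
    qed (simp add: \<Phi>_def extend_def E_def chart_field_def)
    moreover have "smooth_fun A (a b)" "a b p = X p (y b)" for b
      unfolding a_def
      by (intro smooth_fun_diff smooth_fun_mult \<Phi> y vector_field_smooth[OF X]) (simp add: \<Phi> y)
    ultimately show ?thesis by blast
  qed
  show thesis by (rule that[OF \<Phi> E ex])
qed

text \<open>Since \<Phi> is 1 at p, multiplying X by the cube of \<Phi> does not change \<tau> X. In
  the frame expansion of the product every coefficient is 0 at p, so \<tau> kills each term.\<close>

lemma tensorial_zero:
  fixes \<tau> :: "('m \<Rightarrow> 'm tvec) \<Rightarrow> real"
  assumes add: "\<And>X Y. vector_field A X \<Longrightarrow> vector_field A Y \<Longrightarrow>
      \<tau> (\<lambda>q f. X q f + Y q f) = \<tau> X + \<tau> Y"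
    and scale: "\<And>h X. smooth_fun A h \<Longrightarrow> vector_field A X \<Longrightarrow> \<tau> (\<lambda>q f. h q * X q f) = h p * \<tau> X"
    and X: "vector_field A X" "X p = (\<lambda>f. 0)"
  shows "\<tau> X = 0"
proof -
  obtain \<Phi> E y where \<Phi>: "smooth_fun A \<Phi>" "\<Phi> p = 1" and E: "\<And>b. vector_field A (E b)"
    and ex: "\<And>X. vector_field A X \<Longrightarrow> \<exists>a. (\<forall>b. smooth_fun A (a b)) \<and> (\<forall>b. a b p = X p (y b)) \<and>
      (\<forall>q f. \<Phi> q ^ 3 * X q f = (\<Sum>b\<in>B. a b q * E b q f))"
    by (rule vector_field_frame_expansion[of p]) (rule that)
  obtain a where a: "\<And>b. smooth_fun A (a b)" "\<And>b. a b p = X p (y b)"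
    and eq: "\<And>q f. \<Phi> q ^ 3 * X q f = (\<Sum>b\<in>B. a b q * E b q f)"
    using ex[OF X(1)] by blast
  have sum: "\<tau> (\<lambda>q f. \<Sum>b\<in>C. a b q * E b q f) = 0" for C
  proof (induction C rule: infinite_finite_induct)
    case (insert b C)
    then show ?case
      by (simp add: add vector_field_sum vector_field_scale scale a E X(2))
  qed (use scale[OF smooth_fun_const vector_field_zero, of 0] in simp_all)
  have "\<tau> X = \<tau> (\<lambda>q f. \<Phi> q ^ 3 * X q f)"
    using scale[OF smooth_fun_mult[OF \<Phi>(1) smooth_fun_mult[OF \<Phi>(1) \<Phi>(1)]] X(1)] \<Phi>(2)
    by (simp add: power3_eq_cube mult.assoc)
  then show ?thesis by (simp add: eq sum)
qed

lemma tensorial_cong: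
  fixes \<tau> :: "('m \<Rightarrow> 'm tvec) \<Rightarrow> real"
  assumes add: "\<And>X Y. vector_field A X \<Longrightarrow> vector_field A Y \<Longrightarrow>
      \<tau> (\<lambda>q f. X q f + Y q f) = \<tau> X + \<tau> Y"
    and scale: "\<And>h X. smooth_fun A h \<Longrightarrow> vector_field A X \<Longrightarrow> \<tau> (\<lambda>q f. h q * X q f) = h p * \<tau> X"
    and "vector_field A X" "vector_field A Y" "X p = Y p"
  shows "\<tau> X = \<tau> Y"
proof -
  have m: "vector_field A (\<lambda>q f. -1 * Y q f)"
    by (intro vector_field_scale smooth_fun_const assms(4))
  have "\<tau> (\<lambda>q f. X q f + -1 * Y q f) = 0"
    by (rule tensorial_zero[of \<tau>, OF add scale vector_field_add[OF assms(3) m]])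
       (simp_all add: assms(5))
  moreover have "\<tau> (\<lambda>q f. X q f + -1 * Y q f) = \<tau> X + \<tau> (\<lambda>q f. -1 * Y q f)"
    by (rule add[OF assms(3) m])
  moreover have "\<tau> (\<lambda>q f. -1 * Y q f) = -1 * \<tau> Y"
    using scale[OF smooth_fun_const assms(4), of "-1"] .
  ultimately show ?thesis by simp
qed

section \<open>One-forms, two-forms and the exterior derivative\<close>

lemma one_form_cotangent: "one_form A \<xi> \<Longrightarrow> \<xi> p \<in> cotangent_space A p"
  and one_form_smooth: "one_form A \<xi> \<Longrightarrow> vector_field A X \<Longrightarrow> smooth_fun A (\<lambda>q. \<xi> q (X q))"
  by (simp_all add: one_form_def)

lemma one_form_scale:
  assumes "one_form A \<xi>"
  shows "one_form A (\<lambda>q v. c * \<xi> q v)"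
  using assms by (simp add: one_form_def cotangent_space_scale smooth_fun_mult)

lemma one_form_zero: "one_form A (\<lambda>q v. 0)"
  by (simp add: one_form_def cotangent_space_zero)

lemma one_form_eqI:
  assumes "one_form A \<xi>" "one_form A \<zeta>"
    and "\<And>X p. vector_field A X \<Longrightarrow> \<xi> p (X p) = \<zeta> p (X p)"
  shows "\<xi> = \<zeta>"
proof
  fix p
  show "\<xi> p = \<zeta> p"
  proof (rule cotangent_eqI[OF one_form_cotangent one_form_cotangent, OF assms(1,2)])
    fix v assume "v \<in> tangent_space A p"
    then obtain X where "vector_field A X" "X p = v" by (rule tangent_extends)
    then show "\<xi> p v = \<zeta> p v" using assms(3) by blast
  qed
qed

lemma two_form_cotangent:
    "two_form A \<omega> \<Longrightarrow> v \<in> tangent_space A p \<Longrightarrow> \<omega> p v \<in> cotangent_space A p"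
  and two_form_skew: "two_form A \<omega> \<Longrightarrow> \<omega> p v w = - \<omega> p w v"
  and two_form_smooth: "two_form A \<omega> \<Longrightarrow> vector_field A X \<Longrightarrow> vector_field A Y \<Longrightarrow>
    smooth_fun A (\<lambda>p. \<omega> p (X p) (Y p))"
  unfolding two_form_def by blast+

text \<open>The formula that determines d\<xi>, kept as a function of vector fields until
  skew-symmetry and linearity over functions show that it depends only on their values at p.\<close>

definition ext_formula ::
    "('m \<Rightarrow> 'm covec) \<Rightarrow> ('m \<Rightarrow> 'm tvec) \<Rightarrow> ('m \<Rightarrow> 'm tvec) \<Rightarrow> 'm \<Rightarrow> real" where
  "ext_formula \<xi> X Y p =
    X p (\<lambda>q. \<xi> q (Y q)) - Y p (\<lambda>q. \<xi> q (X q)) - \<xi> p (lie_bracket X Y p)"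

lemma ext_formula_swap:
  assumes "one_form A \<xi>" "vector_field A X" "vector_field A Y"
  shows "ext_formula \<xi> Y X p = - ext_formula \<xi> X Y p"
  using cotangent_scale[OF one_form_cotangent[OF assms(1)]
      vector_field_tangent[OF vector_field_bracket[OF assms(2,3)]], of p "-1"]
  by (simp add: ext_formula_def lie_bracket_swap[of Y X])

lemma ext_formula_add:
  assumes \<xi>: "one_form A \<xi>" and X: "vector_field A X" and X': "vector_field A X'" and Y: "vector_field A Y"
  shows "ext_formula \<xi> (\<lambda>q f. X q f + X' q f) Y p = ext_formula \<xi> X Y p + ext_formula \<xi> X' Y p"
  by (simp add: ext_formula_def lie_bracket_add_left[OF X X' Y]
      cotangent_add[OF one_form_cotangent[OF \<xi>]] vector_field_tangent vector_field_bracket X X' Y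
      tangent_add[OF vector_field_tangent[OF Y]] one_form_smooth[OF \<xi>])

text \<open>The derivative Y h enters twice, through Y acting on h * \<xi>(X) and through the
  bracket, with opposite signs.\<close>

lemma ext_formula_scale:
  assumes \<xi>: "one_form A \<xi>" and h: "smooth_fun A h" and X: "vector_field A X" and Y: "vector_field A Y"
  shows "ext_formula \<xi> (\<lambda>q f. h q * X q f) Y p = h p * ext_formula \<xi> X Y p"
proof -
  have "\<xi> p (\<lambda>f. h p * lie_bracket X Y p f - Y p h * X p f) =
      h p * \<xi> p (lie_bracket X Y p) - Y p h * \<xi> p (X p)"
    by (simp add: cotangent_diff[OF one_form_cotangent[OF \<xi>]] cotangent_scale[OF one_form_cotangent[OF \<xi>]]
        vector_field_tangent vector_field_bracket tangent_space_scale X Y)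
  moreover have "\<xi> q (\<lambda>f. h q * X q f) = h q * \<xi> q (X q)" for q
    by (rule cotangent_scale[OF one_form_cotangent[OF \<xi>] vector_field_tangent[OF X]])
  ultimately show ?thesis
    by (simp add: ext_formula_def lie_bracket_scale_left[OF h X Y]
        tangent_mult[OF vector_field_tangent[OF Y] h] one_form_smooth[OF \<xi> X] right_diff_distrib)
qed

lemma ext_formula_cong:
  assumes \<xi>: "one_form A \<xi>" and "vector_field A X" "vector_field A X'" "X p = X' p"
    and "vector_field A Y" "vector_field A Y'" "Y p = Y' p"
  shows "ext_formula \<xi> X Y p = ext_formula \<xi> X' Y' p"
proof -
  have left: "ext_formula \<xi> X Y p = ext_formula \<xi> X' Y p"
    if "vector_field A X" "vector_field A X'" "X p = X' p" "vector_field A Y" for X X' Y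
    by (rule tensorial_cong[where \<tau> = "\<lambda>X. ext_formula \<xi> X Y p"])
       (use that in \<open>auto intro: ext_formula_add[OF \<xi>] ext_formula_scale[OF \<xi>]\<close>)
  have "ext_formula \<xi> X Y p = ext_formula \<xi> X' Y p" by (rule left[OF assms(2-5)])
  also have "\<dots> = - ext_formula \<xi> Y X' p" by (rule ext_formula_swap[OF \<xi> assms(5,3)])
  also have "\<dots> = - ext_formula \<xi> Y' X' p" by (simp only: left[OF assms(5-7,3)])
  also have "\<dots> = ext_formula \<xi> X' Y' p" by (rule ext_formula_swap[OF \<xi> assms(6,3), symmetric])
  finally show ?thesis .
qed

lemma ext_derivative_unique:
  assumes \<omega>: "two_form A \<omega>" "two_form A \<omega>'"
    and eq: "\<And>X Y p. vector_field A X \<Longrightarrow> vector_field A Y \<Longrightarrow> \<omega> p (X p) (Y p) = \<omega>' p (X p) (Y p)"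
  shows "\<omega> = \<omega>'"
proof (intro ext)
  fix p v w
  show "\<omega> p v w = \<omega>' p v w"
  proof (cases "v \<in> tangent_space A p \<and> w \<in> tangent_space A p")
    case True
    then obtain X Y where "vector_field A X" "X p = v" "vector_field A Y" "Y p = w"
      by (meson tangent_extends)
    then show ?thesis using eq by blast
  next
    case False
    \<comment> \<open>If only w fails to be tangent, skew-symmetry moves it to the first place,
      where the default 0 applies.\<close>
    then have "\<omega> p v w = 0 \<and> \<omega>' p v w = 0"
      using \<omega> unfolding two_form_def by (metis neg_equal_0_iff_equal)
    then show ?thesis by simp
  qed
qed

text \<open>Tangent vectors are extended to fields by choice, and the formula is evaluated on the
  extensions. By \<open>ext_formula_cong\<close> the choice is immaterial, so linearity and
  smoothness can be checked on convenient fields.\<close>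

lemma ext_derivative_exists:
  assumes \<xi>: "one_form A \<xi>"
  shows "\<exists>\<omega>. two_form A \<omega> \<and> (\<forall>X Y. vector_field A X \<longrightarrow> vector_field A Y \<longrightarrow>
    (\<forall>p. \<omega> p (X p) (Y p) = ext_formula \<xi> X Y p))"
proof -
  define E where "E p v = (SOME X. vector_field A X \<and> X p = v)" for p v
  have E: "vector_field A (E p v)" "E p v p = v" if "v \<in> tangent_space A p" for p v
    using someI_ex[of "\<lambda>X. vector_field A X \<and> X p = v"] tangent_extends[OF that]
    unfolding E_def by blast+
  define \<omega> where "\<omega> p v w = (if v \<in> tangent_space A p \<and> w \<in> tangent_space A p
    then ext_formula \<xi> (E p v) (E p w) p else 0)" for p v w
  have eq: "\<omega> p (X p) (Y p) = ext_formula \<xi> X Y p" if "vector_field A X" "vector_field A Y" for X Y p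
    using that E[OF vector_field_tangent[OF that(1)]] E[OF vector_field_tangent[OF that(2)]]
    by (auto simp: \<omega>_def vector_field_tangent intro!: ext_formula_cong[OF \<xi>])
  have skew: "\<omega> p v w = - \<omega> p w v" for p v w
    using ext_formula_swap[OF \<xi> E(1) E(1), of w p v p p] by (auto simp: \<omega>_def)
  have cot: "\<omega> p v \<in> cotangent_space A p" if v: "v \<in> tangent_space A p" for p v
  proof (rule cotangentI)
    fix w w' assume w: "w \<in> tangent_space A p" and w': "w' \<in> tangent_space A p"
    have "\<omega> p (\<lambda>f. w f + w' f) v = \<omega> p w v + \<omega> p w' v"
      using eq[OF vector_field_add[OF E(1)[OF w] E(1)[OF w']] E(1)[OF v], of p]
        eq[OF E(1)[OF w] E(1)[OF v], of p] eq[OF E(1)[OF w'] E(1)[OF v], of p]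
        ext_formula_add[OF \<xi> E(1)[OF w] E(1)[OF w'] E(1)[OF v], of p]
      by (simp add: E(2) v w w')
    then show "\<omega> p v (\<lambda>f. w f + w' f) = \<omega> p v w + \<omega> p v w'" by (simp add: skew[of p v])
  next
    fix c w assume w: "w \<in> tangent_space A p"
    have "\<omega> p (\<lambda>f. c * w f) v = c * \<omega> p w v"
      using eq[OF vector_field_scale[OF smooth_fun_const[of c] E(1)[OF w]] E(1)[OF v], of p]
        eq[OF E(1)[OF w] E(1)[OF v], of p]
        ext_formula_scale[OF \<xi> smooth_fun_const[of c] E(1)[OF w] E(1)[OF v], of p]
      by (simp add: E(2) v w)
    then show "\<omega> p v (\<lambda>f. c * w f) = c * \<omega> p v w" by (simp add: skew[of p v])
  qed (simp add: \<omega>_def)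
  have smooth: "smooth_fun A (\<lambda>p. \<omega> p (X p) (Y p))" if "vector_field A X" "vector_field A Y" for X Y
    unfolding eq[OF that] ext_formula_def
    by (intro smooth_fun_diff vector_field_smooth one_form_smooth[OF \<xi>] vector_field_bracket that)
  have "two_form A \<omega>"
    unfolding two_form_def
  proof (intro conjI allI impI ballI)
    show "\<omega> p v = (\<lambda>w. 0)" if "v \<notin> tangent_space A p" for p v using that by (simp add: \<omega>_def fun_eq_iff)
  qed (fact cot skew smooth)+
  then show ?thesis using eq by blast
qed

lemma ext_derivative:
  assumes \<xi>: "one_form A \<xi>"
  shows "two_form A (ext_derivative A \<xi>)"
    and "vector_field A X \<Longrightarrow> vector_field A Y \<Longrightarrow> ext_derivative A \<xi> p (X p) (Y p) = ext_formula \<xi> X Y p"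
proof -
  let ?P = "\<lambda>\<omega>. two_form A \<omega> \<and> (\<forall>X Y. vector_field A X \<longrightarrow> vector_field A Y \<longrightarrow>
    (\<forall>p. \<omega> p (X p) (Y p) = ext_formula \<xi> X Y p))"
  have "\<exists>!\<omega>. ?P \<omega>"
    using ext_derivative_exists[OF \<xi>] by (rule ex_ex1I) (auto intro: ext_derivative_unique)
  from theI'[OF this] have "?P (ext_derivative A \<xi>)"
    unfolding ext_derivative_def ext_formula_def .
  then show "two_form A (ext_derivative A \<xi>)"
    "vector_field A X \<Longrightarrow> vector_field A Y \<Longrightarrow> ext_derivative A \<xi> p (X p) (Y p) = ext_formula \<xi> X Y p"
    by blast+
qed

text \<open>Existence is Cartan's formula.\<close>

lemma lie_derivative_exists:
  assumes X: "vector_field A X" and \<eta>: "one_form A \<eta>"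
  shows "\<exists>\<zeta>. one_form A \<zeta> \<and> (\<forall>Y. vector_field A Y \<longrightarrow>
    (\<forall>p. \<zeta> p (Y p) = X p (\<lambda>q. \<eta> q (Y q)) - \<eta> p (lie_bracket X Y p)))"
proof -
  define \<zeta> where "\<zeta> = (\<lambda>p v. ext_derivative A \<eta> p (X p) v + differential A (\<lambda>q. \<eta> q (X q)) p v)"
  note d = ext_derivative[OF \<eta>]
  have s: "smooth_fun A (\<lambda>q. \<eta> q (X q))" by (rule one_form_smooth[OF \<eta> X])
  have "\<zeta> p (Y p) = X p (\<lambda>q. \<eta> q (Y q)) - \<eta> p (lie_bracket X Y p)" if Y: "vector_field A Y" for Y p
    by (simp add: \<zeta>_def d(2)[OF X Y] differential_def vector_field_tangent[OF Y] ext_formula_def)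
  moreover have "one_form A \<zeta>"
    unfolding one_form_def
  proof (intro conjI allI impI)
    show "\<zeta> p \<in> cotangent_space A p" for p
      unfolding \<zeta>_def
      by (rule cotangent_space_add[OF two_form_cotangent[OF d(1) vector_field_tangent[OF X]]
            differential_cotangent])
    show "smooth_fun A (\<lambda>p. \<zeta> p (Y p))" if Y: "vector_field A Y" for Y
      unfolding \<zeta>_def
      by (rule smooth_fun_add[OF two_form_smooth[OF d(1) X Y]
            one_form_smooth[OF differential_one_form[OF s] Y]])
  qed
  ultimately show ?thesis by blast
qed

lemma lie_derivative:
  assumes X: "vector_field A X" and \<eta>: "one_form A \<eta>"
  shows "one_form A (lie_derivative A X \<eta>)"
    and "vector_field A Y \<Longrightarrow>
      lie_derivative A X \<eta> p (Y p) = X p (\<lambda>q. \<eta> q (Y q)) - \<eta> p (lie_bracket X Y p)"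
proof -
  let ?P = "\<lambda>\<zeta>. one_form A \<zeta> \<and> (\<forall>Y. vector_field A Y \<longrightarrow>
    (\<forall>p. \<zeta> p (Y p) = X p (\<lambda>q. \<eta> q (Y q)) - \<eta> p (lie_bracket X Y p)))"
  have "\<exists>!\<zeta>. ?P \<zeta>"
    using lie_derivative_exists[OF assms] by (rule ex_ex1I) (auto intro: one_form_eqI)
  from theI'[OF this] have "?P (lie_derivative A X \<eta>)"
    unfolding lie_derivative_def .
  then show "one_form A (lie_derivative A X \<eta>)"
    "vector_field A Y \<Longrightarrow>
      lie_derivative A X \<eta> p (Y p) = X p (\<lambda>q. \<eta> q (Y q)) - \<eta> p (lie_bracket X Y p)"
    by blast+
qed


section \<open>The Courant product\<close>

lemma lie_bracket_self: "lie_bracket X X p = (\<lambda>f. 0)"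
  by (simp add: lie_bracket_def)

lemma lie_bracket_cmult_left:
  "vector_field A X \<Longrightarrow> vector_field A Y \<Longrightarrow>
    lie_bracket (\<lambda>q f. c * X q f) Y p = (\<lambda>f. c * lie_bracket X Y p f)"
  by (subst lie_bracket_scale_left[OF smooth_fun_const])
     (simp_all add: tangent_const[OF vector_field_tangent])

lemma lie_bracket_cmult_right:
  assumes "vector_field A X" "vector_field A Y"
  shows "lie_bracket X (\<lambda>q f. c * Y q f) p = (\<lambda>f. c * lie_bracket X Y p f)"
  using lie_bracket_cmult_left[OF assms(2,1), of c p]
  by (simp add: lie_bracket_swap[of X] fun_eq_iff)

lemma
  assumes "two_form A \<omega>"
  shows two_form_scale_left: "v \<in> tangent_space A p \<Longrightarrow> \<omega> p (\<lambda>f. c * v f) w = c * \<omega> p v w"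
    and two_form_diagonal: "\<omega> p v v = 0"
proof -
  show "\<omega> p v v = 0" using two_form_skew[OF assms, of p v v] by simp
  show "\<omega> p (\<lambda>f. c * v f) w = c * \<omega> p v w" if v: "v \<in> tangent_space A p"
  proof (cases "w \<in> tangent_space A p")
    case True
    have "\<omega> p w (\<lambda>f. c * v f) = c * \<omega> p w v"
      by (rule cotangent_scale[OF two_form_cotangent[OF assms True] v])
    then show ?thesis
      using two_form_skew[OF assms, of p "\<lambda>f. c * v f" w] two_form_skew[OF assms, of p v w] by simp
  next
    case False
    then show ?thesis
      by (simp add: cotangent_outside[OF two_form_cotangent[OF assms v] False]
          cotangent_outside[OF two_form_cotangent[OF assms tangent_space_scale[OF v]] False])
  qed
qed

lemma two_form_scale:
  assumes "two_form A \<omega>"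
  shows "two_form A (\<lambda>p v w. c * \<omega> p v w)"
  unfolding two_form_def
proof (intro conjI allI impI ballI)
  show "(\<lambda>w. c * \<omega> p v w) \<in> cotangent_space A p" if "v \<in> tangent_space A p" for p v
    by (rule cotangent_space_scale[OF two_form_cotangent[OF assms that]])
  show "(\<lambda>w. c * \<omega> p v w) = (\<lambda>w. 0)" if "v \<notin> tangent_space A p" for p v
    using assms that unfolding two_form_def by simp
  show "c * \<omega> p v w = - (c * \<omega> p w v)" for p v w
    using two_form_skew[OF assms, of p v w] by simp
  show "smooth_fun A (\<lambda>p. c * \<omega> p (X p) (Y p))" if "vector_field A X" "vector_field A Y" for X Y
    by (rule smooth_fun_mult[OF smooth_fun_const two_form_smooth[OF assms that]])
qed

lemma ext_derivative_scale:
  assumes \<xi>: "one_form A \<xi>"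
  shows "ext_derivative A (\<lambda>q v. c * \<xi> q v) = (\<lambda>p v w. c * ext_derivative A \<xi> p v w)"
proof (rule ext_derivative_unique)
  show "two_form A (ext_derivative A (\<lambda>q v. c * \<xi> q v))"
    by (rule ext_derivative(1)[OF one_form_scale[OF \<xi>]])
  show "two_form A (\<lambda>p v w. c * ext_derivative A \<xi> p v w)"
    by (rule two_form_scale[OF ext_derivative(1)[OF \<xi>]])
  fix X Y p assume X: "vector_field A X" and Y: "vector_field A Y"
  show "ext_derivative A (\<lambda>q v. c * \<xi> q v) p (X p) (Y p) = c * ext_derivative A \<xi> p (X p) (Y p)"
    by (simp add: ext_derivative(2)[OF one_form_scale[OF \<xi>] X Y] ext_derivative(2)[OF \<xi> X Y]
        ext_formula_def tangent_cmult[OF vector_field_tangent[OF X]]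
        tangent_cmult[OF vector_field_tangent[OF Y]] one_form_smooth[OF \<xi>] X Y right_diff_distrib)
qed

lemma ext_derivative_zero: "ext_derivative A (\<lambda>q v. 0) p v w = 0"
  using ext_derivative_scale[OF one_form_zero, of 0] by (simp add: fun_eq_iff)

lemma lie_derivative_scale_right:
  assumes X: "vector_field A X" and \<eta>: "one_form A \<eta>"
  shows "lie_derivative A X (\<lambda>q v. c * \<eta> q v) = (\<lambda>p v. c * lie_derivative A X \<eta> p v)"
proof (rule one_form_eqI)
  show "one_form A (lie_derivative A X (\<lambda>q v. c * \<eta> q v))"
    by (rule lie_derivative(1)[OF X one_form_scale[OF \<eta>]])
  show "one_form A (\<lambda>p v. c * lie_derivative A X \<eta> p v)"
    by (rule one_form_scale[OF lie_derivative(1)[OF X \<eta>]])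
  fix Y p assume Y: "vector_field A Y"
  show "lie_derivative A X (\<lambda>q v. c * \<eta> q v) p (Y p) = c * lie_derivative A X \<eta> p (Y p)"
    by (simp add: lie_derivative(2)[OF X one_form_scale[OF \<eta>] Y] lie_derivative(2)[OF X \<eta> Y]
        tangent_cmult[OF vector_field_tangent[OF X]] one_form_smooth[OF \<eta> Y] right_diff_distrib)
qed

text \<open>The term with Y h in the bracket of h X with Y, fed to \<eta>, produces \<eta>(X) dh,
  the covector part of \<open>anomaly\<close>.\<close>

lemma lie_derivative_scale_left:
  assumes h: "smooth_fun A h" and X: "vector_field A X" and \<eta>: "one_form A \<eta>"
  shows "lie_derivative A (\<lambda>q f. h q * X q f) \<eta> p v =
    h p * lie_derivative A X \<eta> p v + \<eta> p (X p) * differential A h p v"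
proof (cases "v \<in> tangent_space A p")
  case True
  then obtain Y where Y: "vector_field A Y" "Y p = v" by (rule tangent_extends)
  have "\<eta> p (\<lambda>f. h p * lie_bracket X Y p f - Y p h * X p f) =
      h p * \<eta> p (lie_bracket X Y p) - Y p h * \<eta> p (X p)"
    by (simp add: cotangent_diff[OF one_form_cotangent[OF \<eta>]] cotangent_scale[OF one_form_cotangent[OF \<eta>]]
        vector_field_tangent vector_field_bracket tangent_space_scale X Y)
  then show ?thesis
    using True lie_derivative(2)[OF vector_field_scale[OF h X] \<eta> Y(1), of p]
      lie_derivative(2)[OF X \<eta> Y(1), of p]
    by (simp add: Y(2) lie_bracket_scale_left[OF h X Y(1)] differential_def right_diff_distrib)
next
  case False
  then show ?thesis
    using cotangent_outside[OF one_form_cotangent[OF lie_derivative(1)[OF _ \<eta>]]]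
      vector_field_scale[OF h X] X by (simp add: differential_def)
qed

lemma smooth_section_pair:
  "smooth_section A u \<longleftrightarrow> (\<exists>X \<xi>. u = (\<lambda>p. (X p, \<xi> p)) \<and> vector_field A X \<and> one_form A \<xi>)"
proof
  assume "smooth_section A u"
  then show "\<exists>X \<xi>. u = (\<lambda>p. (X p, \<xi> p)) \<and> vector_field A X \<and> one_form A \<xi>"
    unfolding smooth_section_def
    by (intro exI[of _ "\<lambda>p. fst (u p)"] exI[of _ "\<lambda>p. snd (u p)"]) simp
qed (auto simp: smooth_section_def)

lemma courant_product_pair:
  "courant_product A (\<lambda>p. (X p, \<xi> p)) (\<lambda>p. (Y p, \<eta> p)) =
    (\<lambda>p. (lie_bracket X Y p, \<lambda>w. lie_derivative A X \<eta> p w - ext_derivative A \<xi> p (Y p) w))"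
  by (simp add: courant_product_def contraction_def)

text \<open>With a zero one-form on the left the term with d\<xi> drops out. Such left factors are
  all that is needed for the pointwise condition and for the constancy of \<kappa>.\<close>

lemma courant_product_vector:
  "courant_product A (\<lambda>p. (X p, \<lambda>v. 0)) v =
    (\<lambda>p. (lie_bracket X (\<lambda>q. fst (v q)) p, lie_derivative A X (\<lambda>q. snd (v q)) p))"
  using courant_product_pair[of X "\<lambda>p v. 0" "\<lambda>q. fst (v q)" "\<lambda>q. snd (v q)"]
  by (simp add: ext_derivative_zero)

lemma section_fibre: "smooth_section A u \<Longrightarrow> u p \<in> fibre A p"
  by (auto simp: smooth_section_pair fibre_def vector_field_tangent one_form_cotangent)

lemma fibre_extends:
  assumes "a \<in> fibre A p"
  obtains u where "smooth_section A u" "u p = a"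
proof -
  have a: "fst a \<in> tangent_space A p" "snd a \<in> cotangent_space A p"
    using assms by (auto simp: fibre_def)
  obtain X where "vector_field A X" "X p = fst a" using a(1) by (rule tangent_extends)
  moreover obtain f where "smooth_fun A f" "snd a = differential A f p"
    using a(2) by (rule cotangent_is_differential)
  ultimately show thesis
    using that[of "\<lambda>q. (X q, differential A f q)"] differential_one_form
    by (auto simp: smooth_section_def prod_eq_iff)
qed

lemma courant_product_fibre:
  assumes "smooth_section A u" "smooth_section A v"
  shows "courant_product A u v p \<in> fibre A p"
proof -
  obtain X \<xi> Y \<eta> where u: "u = (\<lambda>p. (X p, \<xi> p))" "vector_field A X" "one_form A \<xi>"
    and v: "v = (\<lambda>p. (Y p, \<eta> p))" "vector_field A Y" "one_form A \<eta>"
    using assms unfolding smooth_section_pair by blast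
  have "(\<lambda>w. lie_derivative A X \<eta> p w + -1 * ext_derivative A \<xi> p (Y p) w) \<in> cotangent_space A p"
    by (rule cotangent_space_add[OF one_form_cotangent[OF lie_derivative(1)[OF u(2) v(3)]]
          cotangent_space_scale[OF two_form_cotangent[OF ext_derivative(1)[OF u(3)]
          vector_field_tangent[OF v(2)]]]])
  then show ?thesis
    unfolding u(1) v(1) courant_product_pair fibre_def
    using vector_field_tangent[OF vector_field_bracket[OF u(2) v(2)]] by simp
qed

lemma courant_product_scale_right:
  assumes "smooth_section A u" "smooth_section A v"
  shows "courant_product A u (\<lambda>p. gscale c (v p)) = (\<lambda>p. gscale c (courant_product A u v p))"
proof -
  obtain X \<xi> Y \<eta> where u: "u = (\<lambda>p. (X p, \<xi> p))" "vector_field A X" "one_form A \<xi>"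
    and v: "v = (\<lambda>p. (Y p, \<eta> p))" "vector_field A Y" "one_form A \<eta>"
    using assms unfolding smooth_section_pair by blast
  show ?thesis
    by (simp add: u(1) v(1) gscale_def courant_product_pair lie_bracket_cmult_right[OF u(2) v(2)]
        lie_derivative_scale_right[OF u(2) v(3)] right_diff_distrib
        two_form_scale_left[OF ext_derivative(1)[OF u(3)] vector_field_tangent[OF v(2)]])
qed

lemma courant_product_self_scale_left:
  assumes "smooth_section A v"
  shows "courant_product A (\<lambda>p. gscale c (v p)) v = (\<lambda>p. gscale c (courant_product A v v p))"
proof -
  obtain Y \<eta> where v: "v = (\<lambda>p. (Y p, \<eta> p))" "vector_field A Y" "one_form A \<eta>"
    using assms unfolding smooth_section_pair by blast
  have "lie_derivative A (\<lambda>q f. c * Y q f) \<eta> p w = c * lie_derivative A Y \<eta> p w" for p w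
    using lie_derivative_scale_left[OF smooth_fun_const v(2,3), of c p w]
    by (simp add: differential_def tangent_const)
  then show ?thesis
    by (simp add: v(1) gscale_def courant_product_pair lie_bracket_cmult_left[OF v(2) v(2)]
        ext_derivative_scale[OF v(3)] right_diff_distrib)
qed

text \<open>The failure of \<open>u \<circ> v\<close> to be linear over functions in a vector field \<open>u\<close>.\<close>

definition anomaly :: "'m \<Rightarrow> ('m \<Rightarrow> real) \<Rightarrow> 'm tvec \<Rightarrow> 'm gvec \<Rightarrow> 'm gvec" where
  "anomaly p f x a = (\<lambda>g. - (fst a f * x g), \<lambda>w. snd a x * differential A f p w)"

lemma anomaly_fibre: "x \<in> tangent_space A p \<Longrightarrow> anomaly p f x a \<in> fibre A p"
  using tangent_space_scale[of x A p "- fst a f"]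
  by (simp add: anomaly_def fibre_def cotangent_space_scale differential_cotangent)

lemma courant_product_function_scale_left:
  assumes h: "smooth_fun A h" and X: "vector_field A X" and v: "smooth_section A v"
  shows "courant_product A (\<lambda>p. (\<lambda>f. h p * X p f, \<lambda>w. 0)) v p =
    gadd (gscale (h p) (courant_product A (\<lambda>p. (X p, \<lambda>w. 0)) v p)) (anomaly p h (X p) (v p))"
proof -
  have v': "vector_field A (\<lambda>q. fst (v q))" "one_form A (\<lambda>q. snd (v q))"
    using v by (simp_all add: smooth_section_def)
  show ?thesis
    unfolding courant_product_vector gadd_def gscale_def anomaly_def
      lie_bracket_scale_left[OF h X v'(1)] lie_derivative_scale_left[OF h X v'(2), abs_def]
    by (simp add: fun_eq_iff lie_derivative_scale_left[OF h X v'(2)])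
qed

lemma vector_zero_section: "vector_field A X \<Longrightarrow> smooth_section A (\<lambda>p. (X p, \<lambda>w. 0))"
  by (simp add: smooth_section_def one_form_zero)

section \<open>The pointwise condition and its solutions on a fibre\<close>

text \<open>The product with f X on the left is expanded for v and for \<Delta> v. Linearity of
  \<Delta> on the fibre and the hypothesis for X itself make f p times \<Delta> (X \<circ> v) appear
  in both results. Cancelling it leaves the anomalies, which see only the values of X and v at
  p.\<close>

lemma anomaly_equivariant:
  assumes \<Delta>: "bundle_morphism A \<Delta>"
    and comm: "\<And>u v. smooth_section A u \<Longrightarrow> smooth_section A v \<Longrightarrow>
      courant_product A u (on_sections \<Delta> v) = on_sections \<Delta> (courant_product A u v)"
    and a: "a \<in> fibre A p" and x: "x \<in> tangent_space A p" and f: "smooth_fun A f"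
  shows "\<Delta> p (anomaly p f x a) = anomaly p f x (\<Delta> p a)"
proof -
  obtain v where v: "smooth_section A v" "v p = a" using a by (rule fibre_extends)
  obtain X where X: "vector_field A X" "X p = x" using x by (rule tangent_extends)
  let ?X = "\<lambda>p. (X p, \<lambda>w. 0)" and ?fX = "\<lambda>p. (\<lambda>g. f p * X p g, \<lambda>w. 0)"
  have s: "smooth_section A ?X" "smooth_section A ?fX"
    using X f by (auto intro: vector_zero_section vector_field_scale)
  have v': "smooth_section A (on_sections \<Delta> v)"
    using \<Delta> v(1) by (simp add: bundle_morphism_def on_sections_def)
  have v'p: "on_sections \<Delta> v p = \<Delta> p a" by (simp add: on_sections_def v(2))
  let ?b = "courant_product A ?X v p"
  have b: "?b \<in> fibre A p" by (rule courant_product_fibre[OF s(1) v(1)])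
  have fb: "gscale (f p) ?b \<in> fibre A p"
    using b by (auto simp: fibre_def gscale_def tangent_space_scale cotangent_space_scale)
  have "\<Delta> p (gadd (gscale (f p) ?b) (anomaly p f x a)) =
      on_sections \<Delta> (courant_product A ?fX v) p"
    unfolding on_sections_def
    by (simp add: courant_product_function_scale_left[OF f X(1) v(1)] X(2) v(2))
  also have "\<dots> = courant_product A ?fX (on_sections \<Delta> v) p"
    by (simp only: comm[OF s(2) v(1)])
  also have "\<dots> = gadd (gscale (f p) (\<Delta> p ?b)) (anomaly p f x (\<Delta> p a))"
    unfolding courant_product_function_scale_left[OF f X(1) v'] comm[OF s(1) v(1)]
    by (simp add: v'p X(2)) (simp add: on_sections_def)
  finally have "gadd (gscale (f p) (\<Delta> p ?b)) (\<Delta> p (anomaly p f x a)) =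
      gadd (gscale (f p) (\<Delta> p ?b)) (anomaly p f x (\<Delta> p a))"
    using \<Delta> b fb anomaly_fibre[OF x] by (simp add: bundle_morphism_def)
  then show ?thesis by (auto simp: gadd_def fun_eq_iff prod_eq_iff)
qed

text \<open>The map is split into four blocks: \<alpha> and \<delta> preserve tangent and cotangent
  vectors, \<gamma> and \<beta> exchange them. Purely tangent and purely cotangent arguments
  separate the blocks, and the test pair \<open>x0\<close>, \<open>f0\<close> reads off the two
  scalars.\<close>

lemma fibre_endomorphism_scalar:
  assumes \<Delta>: "bundle_morphism A \<Delta>"
    and eqv: "\<And>f x a. a \<in> fibre A p \<Longrightarrow> x \<in> tangent_space A p \<Longrightarrow> smooth_fun A f \<Longrightarrow>
      \<Delta> p (anomaly p f x a) = anomaly p f x (\<Delta> p a)"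
    and x0: "x0 \<in> tangent_space A p" and f0: "smooth_fun A f0" "x0 f0 = 1"
  shows "\<exists>\<kappa> \<mu>. \<forall>a\<in>fibre A p. \<Delta> p a = (\<lambda>f. \<kappa> * fst a f, \<lambda>w. \<mu> * snd a w)"
proof -
  have fib: "\<Delta> p a \<in> fibre A p" if "a \<in> fibre A p" for a
    using \<Delta> that by (simp add: bundle_morphism_def)
  have add: "\<Delta> p (gadd a b) = gadd (\<Delta> p a) (\<Delta> p b)" if "a \<in> fibre A p" "b \<in> fibre A p" for a b
    using \<Delta> that by (simp add: bundle_morphism_def)
  have scale: "\<Delta> p (gscale c a) = gscale c (\<Delta> p a)" if "a \<in> fibre A p" for a c
    using \<Delta> that by (simp add: bundle_morphism_def)
  define \<alpha> where "\<alpha> y = fst (\<Delta> p (y, \<lambda>w. 0))" for y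
  define \<gamma> where "\<gamma> y = snd (\<Delta> p (y, \<lambda>w. 0))" for y
  define \<beta> where "\<beta> \<eta> = fst (\<Delta> p (\<lambda>f. 0, \<eta>))" for \<eta>
  define \<delta> where "\<delta> \<eta> = snd (\<Delta> p (\<lambda>f. 0, \<eta>))" for \<eta>
  have vf: "(y, \<lambda>w. 0) \<in> fibre A p" if "y \<in> tangent_space A p" for y
    using that by (simp add: fibre_def cotangent_space_zero)
  have cf: "(\<lambda>f. 0, \<eta>) \<in> fibre A p" if "\<eta> \<in> cotangent_space A p" for \<eta>
    using that by (simp add: fibre_def tangent_space_zero)
  \<comment> \<open>For a = (y, 0) the anomaly is - y f times (x, 0), so the condition compares
    \<Delta> on two tangent vectors.\<close>
  have vec: "gscale (- y f) (\<Delta> p (x, \<lambda>w. 0)) = anomaly p f x (\<Delta> p (y, \<lambda>w. 0))"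
    if "y \<in> tangent_space A p" "x \<in> tangent_space A p" "smooth_fun A f" for y x f
    using eqv[OF vf[OF that(1)] that(2,3)] scale[OF vf[OF that(2)], of "- y f"]
    by (simp add: anomaly_def gscale_def)
  \<comment> \<open>For a = (0, \<eta>) the anomaly is \<eta> x times (0, df).\<close>
  have cov: "gscale (\<eta> x) (\<Delta> p (\<lambda>f. 0, differential A f p)) = anomaly p f x (\<Delta> p (\<lambda>f. 0, \<eta>))"
    if "\<eta> \<in> cotangent_space A p" "x \<in> tangent_space A p" "smooth_fun A f" for \<eta> x f
    using eqv[OF cf[OF that(1)] that(2,3)] scale[OF cf[OF differential_cotangent], of "\<eta> x" f]
    by (simp add: anomaly_def gscale_def)
  have \<alpha>: "y f * \<alpha> x g = \<alpha> y f * x g"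
    and \<gamma>: "- (y f) * \<gamma> x w = \<gamma> y x * differential A f p w"
    if "y \<in> tangent_space A p" "x \<in> tangent_space A p" "smooth_fun A f" for y x f g w
    using vec[OF that] by (simp_all add: anomaly_def gscale_def \<alpha>_def \<gamma>_def prod_eq_iff fun_eq_iff)
  have \<beta>: "\<eta> x * \<beta> (differential A f p) g = - (\<beta> \<eta> f * x g)"
    and \<delta>: "\<eta> x * \<delta> (differential A f p) w = \<delta> \<eta> x * differential A f p w"
    if "\<eta> \<in> cotangent_space A p" "x \<in> tangent_space A p" "smooth_fun A f" for \<eta> x f g w
    using cov[OF that] by (simp_all add: anomaly_def gscale_def \<beta>_def \<delta>_def prod_eq_iff fun_eq_iff)
  define \<kappa> where "\<kappa> = \<alpha> x0 f0"
  define \<mu> where "\<mu> = \<delta> (differential A f0 p) x0"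
  have \<alpha>': "\<alpha> x = (\<lambda>g. \<kappa> * x g)" if "x \<in> tangent_space A p" for x
    using \<alpha>[OF x0 that f0(1)] by (simp add: \<kappa>_def f0(2) fun_eq_iff)
  have \<delta>': "\<delta> \<eta> x = \<mu> * \<eta> x" if \<eta>: "\<eta> \<in> cotangent_space A p" for \<eta> x
  proof (cases "x \<in> tangent_space A p")
    case True
    show ?thesis
      using \<delta>[OF \<eta> True f0(1), of x0] by (simp add: \<mu>_def differential_def x0 f0(2) mult.commute)
  next
    case False
    then show ?thesis
      using cotangent_outside[of "\<delta> \<eta>" A p x] cotangent_outside[OF \<eta>] fib[OF cf[OF \<eta>]]
      by (simp add: \<delta>_def fibre_def mem_Times_iff)
  qed
  have \<gamma>cot: "\<gamma> y \<in> cotangent_space A p" if "y \<in> tangent_space A p" for y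
    using fib[OF vf[OF that]] by (simp add: \<gamma>_def fibre_def mem_Times_iff)
  have nz: "\<exists>f. smooth_fun A f \<and> x f \<noteq> 0" if "x \<in> tangent_space A p" "x \<noteq> (\<lambda>f. 0)" for x
    using that tangent_eqI[OF that(1) tangent_space_zero] by blast
  \<comment> \<open>For y = w = x the relation says that x f * \<gamma> x x equals its own negative,
    so \<gamma> vanishes on the diagonal. With this, the relation for arbitrary y and w = x makes
    \<gamma> y x vanish.\<close>
  have \<gamma>0: "\<gamma> x x = 0" if x: "x \<in> tangent_space A p" for x
  proof (cases "x = (\<lambda>f. 0)")
    case True
    then show ?thesis using cotangent_null \<gamma>cot[OF x] by simp
  next
    case False
    then obtain f where "smooth_fun A f" "x f \<noteq> 0" using nz[OF x] by blast
    then show ?thesis using \<gamma>[OF x x, of f x] by (simp add: differential_def x)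
  qed
  have "\<gamma> y x = 0" if y: "y \<in> tangent_space A p" and x: "x \<in> tangent_space A p" for y x
  proof (cases "x = (\<lambda>f. 0)")
    case True
    then show ?thesis using cotangent_null \<gamma>cot[OF y] by simp
  next
    case False
    then obtain f where "smooth_fun A f" "x f \<noteq> 0" using nz[OF x] by blast
    then show ?thesis using \<gamma>[OF y x, of f x] by (simp add: differential_def x \<gamma>0)
  qed
  then have \<gamma>': "\<gamma> y = (\<lambda>w. 0)" if "y \<in> tangent_space A p" for y
    by (rule cotangent_eqI[OF \<gamma>cot[OF that] cotangent_space_zero]) (simp add: that)
  have \<beta>tan: "\<beta> \<eta> \<in> tangent_space A p" if "\<eta> \<in> cotangent_space A p" for \<eta>
    using fib[OF cf[OF that]] by (simp add: \<beta>_def fibre_def mem_Times_iff)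
  \<comment> \<open>For \<eta> = df and g = f the relation says that x f * \<beta> \<eta> f equals
    its own negative. If x f \<noteq> 0, then \<beta> \<eta> f = 0, and the relation for general g
    gives \<beta> \<eta> = 0. If no such x exists, then \<eta> = 0.\<close>
  have \<beta>': "\<beta> \<eta> = (\<lambda>f. 0)" if \<eta>: "\<eta> \<in> cotangent_space A p" for \<eta>
  proof -
    obtain f where f: "smooth_fun A f" "\<eta> = differential A f p"
      using \<eta> by (rule cotangent_is_differential)
    show ?thesis
    proof (cases "\<exists>x\<in>tangent_space A p. x f \<noteq> 0")
      case True
      then obtain x where x: "x \<in> tangent_space A p" "x f \<noteq> 0" by blast
      have \<eta>x: "\<eta> x = x f" by (simp add: f(2) differential_def x(1))
      have "\<beta> \<eta> f = 0" using \<beta>[OF \<eta> x(1) f(1), of f] x(2) by (simp add: \<eta>x flip: f(2))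
      then show ?thesis using \<beta>[OF \<eta> x(1) f(1)] x(2) by (simp add: \<eta>x fun_eq_iff flip: f(2))
    next
      case False
      then have "\<eta> = (\<lambda>w. 0)" by (auto simp: f(2) differential_def fun_eq_iff)
      then show ?thesis
        using scale[OF cf[OF \<eta>], of 0] by (simp add: \<beta>_def gscale_def prod_eq_iff)
    qed
  qed
  have "\<Delta> p a = (\<lambda>f. \<kappa> * fst a f, \<lambda>w. \<mu> * snd a w)" if "a \<in> fibre A p" for a
  proof -
    have a: "fst a \<in> tangent_space A p" "snd a \<in> cotangent_space A p"
      using that by (auto simp: fibre_def)
    have "a = gadd (fst a, \<lambda>w. 0) (\<lambda>f. 0, snd a)" by (simp add: gadd_def)
    then have "\<Delta> p a = gadd (\<Delta> p (fst a, \<lambda>w. 0)) (\<Delta> p (\<lambda>f. 0, snd a))"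
      using add[OF vf[OF a(1)] cf[OF a(2)]] by simp
    also have "\<dots> = gadd (\<alpha> (fst a), \<gamma> (fst a)) (\<beta> (snd a), \<delta> (snd a))"
      by (simp add: \<alpha>_def \<beta>_def \<gamma>_def \<delta>_def)
    also have "\<dots> = (\<lambda>f. \<kappa> * fst a f, \<lambda>w. \<mu> * snd a w)"
      by (simp add: gadd_def \<alpha>'[OF a(1)] \<beta>'[OF a(2)] \<gamma>'[OF a(1)] \<delta>'[OF a(2)])
    finally show ?thesis .
  qed
  then show ?thesis by blast
qed

section \<open>From the fibres to one global scalar\<close>

text \<open>This supplies the test pair of \<open>fibre_endomorphism_scalar\<close> in positive
  dimension: w is scaled so that its component along b is 1.\<close>

lemma tangent_nontrivial:
  fixes w :: 'e
  assumes "w \<noteq> 0"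
  obtains x f where "x \<in> tangent_space A p" "smooth_fun A f" "x f = 1"
proof -
  obtain U \<psi> where c: "(U, \<psi>) \<in> A" "p \<in> U" using chart_at by blast
  obtain r \<phi> where cut: "cutoff U \<psi> p r \<phi>" using cutoff_exists[OF c] by blast
  obtain b where b: "w \<bullet> b \<noteq> 0"
    using assms inner_eq_zero_iff[of w] by blast
  define x where "x = chart_vector U \<psi> p ((1 / (w \<bullet> b)) *\<^sub>R w)"
  have "x (coord U \<psi> p \<phi> b) = 1"
    unfolding x_def chart_vector_coord[OF cut c(2)] using cut b by (simp add: cutoff_def)
  then show thesis
    using that[of x "coord U \<psi> p \<phi> b"] chart_vector_tangent[OF c] coord_smooth[OF cut] x_def by blast
qed

lemma tangent_trivial:
  assumes "\<And>w::'e. w = 0" and x: "x \<in> tangent_space A p"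
  shows "x = (\<lambda>f. 0)"
proof -
  obtain U \<psi> where c: "(U, \<psi>) \<in> A" "p \<in> U" using chart_at by blast
  obtain w where w: "x = chart_vector U \<psi> p w" using tangent_is_chart_vector[OF c x] by blast
  have "chart_vector U \<psi> p 0 f = 0" for f
    by (subst chart_vector_expand[OF c]) simp
  then show ?thesis using w assms(1)[of w] by (simp add: fun_eq_iff)
qed

text \<open>No regularity of \<kappa> is assumed; near p it is the quotient h / g of smooth
  functions. The numerator dh * g - h * dg of the derivative is 0 because dh = \<kappa> dg and h =
  \<kappa> g at each point.\<close>

lemma locally_constant_factor:
  assumes g: "smooth_fun A g" and h: "smooth_fun A h" and "g p \<noteq> 0"
    and hg: "\<And>q. h q = \<kappa> q * g q"
    and X: "\<And>X q. vector_field A X \<Longrightarrow> X q h = \<kappa> q * X q g"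
  shows "\<exists>T. open T \<and> p \<in> T \<and> (\<forall>q\<in>T. \<kappa> q = \<kappa> p)"
proof -
  obtain U \<psi> where c: "(U, \<psi>) \<in> A" "p \<in> U" using chart_at by blast
  define G where "G = (\<lambda>x. g (inv_into U \<psi> x))"
  define H where "H = (\<lambda>x. h (inv_into U \<psi> x))"
  have "continuous_on (\<psi> ` U) G"
    unfolding G_def by (rule smooth_on_continuous_on[OF smooth_funD[OF g c(1)]])
  then have "open (\<psi> ` U \<inter> G -` (- {0}))"
    by (rule continuous_open_preimage[OF _ chart_image_open[OF c(1)]]) auto
  moreover have "\<psi> p \<in> \<psi> ` U \<inter> G -` (- {0})"
    using c(2) assms(3) by (simp add: G_def chart_inv[OF c])
  ultimately obtain r where r: "r > 0" "ball (\<psi> p) r \<subseteq> \<psi> ` U \<inter> G -` (- {0})"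
    by (meson openE)
  define T where "T = U \<inter> \<psi> -` ball (\<psi> p) r"
  have "continuous_on U \<psi>" using chart_homeomorphism[OF c(1)] by (rule homeomorphism_cont1)
  then have "open T"
    unfolding T_def by (rule continuous_open_preimage[OF _ chart_open[OF c(1)] open_ball])
  have const: "H x / G x = H y / G y" if "x \<in> ball (\<psi> p) r" "y \<in> ball (\<psi> p) r" for x y
  proof (rule has_derivative_zero_unique[OF convex_ball _ that])
    fix x assume x: "x \<in> ball (\<psi> p) r"
    with r(2) have "x \<in> \<psi> ` U" and Gx: "G x \<noteq> 0" by auto
    then obtain q where q: "q \<in> U" "x = \<psi> q" by blast
    note dG = chart_differentiable[OF c(1) q(1) g, folded G_def q(2), unfolded frechet_derivative_works]
    note dH = chart_differentiable[OF c(1) q(1) h, folded H_def q(2), unfolded frechet_derivative_works]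
    have "frechet_derivative H (at x) w * G x - H x * frechet_derivative G (at x) w = 0" for w
    proof -
      \<comment> \<open>Every direction at q is the value of a global vector field, to which the
        hypothesis on fields applies.\<close>
      obtain X where X': "vector_field A X" "X q = chart_vector U \<psi> q w"
        using chart_vector_tangent[OF c(1) q(1)] by (rule tangent_extends)
      have "frechet_derivative H (at x) w = \<kappa> q * frechet_derivative G (at x) w"
        using X[OF X'(1), of q] g h by (simp add: X'(2) chart_vector_def G_def H_def q(2))
      moreover have "H x = \<kappa> q * G x"
        by (simp add: G_def H_def q(2) chart_inv[OF c(1) q(1)] hg)
      ultimately show ?thesis by simp
    qed
    then have "((\<lambda>x. H x / G x) has_derivative (\<lambda>w. 0)) (at x)"
      using has_derivative_divide'[OF dH dG Gx] by simp
    then show "((\<lambda>x. H x / G x) has_derivative (\<lambda>w. 0)) (at x within ball (\<psi> p) r)"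
      by (rule has_derivative_at_withinI)
  qed
  have quot: "H (\<psi> q) / G (\<psi> q) = \<kappa> q" if "q \<in> T" for q
    using that r(2) by (auto simp: T_def G_def H_def chart_inv[OF c(1)] hg)
  have "p \<in> T" using c(2) r(1) by (simp add: T_def)
  moreover have "\<kappa> q = \<kappa> p" if "q \<in> T" for q
    using const[of "\<psi> q" "\<psi> p"] quot[OF that] quot[OF \<open>p \<in> T\<close>] that \<open>p \<in> T\<close> by (simp add: T_def)
  ultimately show ?thesis using \<open>open T\<close> by blast
qed

lemma equivariant_imp_scalar:
  assumes conn: "connected (UNIV :: 'm set)" and \<Delta>: "bundle_morphism A \<Delta>"
    and comm: "\<And>u v. smooth_section A u \<Longrightarrow> smooth_section A v \<Longrightarrow>
      courant_product A u (on_sections \<Delta> v) = on_sections \<Delta> (courant_product A u v)"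
    and square: "\<And>v. smooth_section A v \<Longrightarrow>
      on_sections \<Delta> (courant_product A v v) = courant_product A (on_sections \<Delta> v) v"
  shows "\<exists>c. \<forall>p. \<forall>a\<in>fibre A p. \<Delta> p a = gscale c a"
proof (cases "\<forall>w::'e. w = 0")
  \<comment> \<open>In dimension 0 every fibre is trivial, so the scalar 0 serves.\<close>
  case True
  then have T: "x = (\<lambda>f. 0)" if "x \<in> tangent_space A p" for x p
    using tangent_trivial[OF _ that] by blast
  have "\<alpha> = (\<lambda>w. 0)" if "\<alpha> \<in> cotangent_space A p" for \<alpha> p
  proof (rule cotangent_eqI[OF that cotangent_space_zero])
    fix w assume "w \<in> tangent_space A p"
    from T[OF this] cotangent_null[OF that] show "\<alpha> w = 0" by simp
  qed
  with T have zero: "a = (\<lambda>f. 0, \<lambda>w. 0)" if "a \<in> fibre A p" for a p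
    using that by (fastforce simp: fibre_def)
  have "\<Delta> p a \<in> fibre A p" if "a \<in> fibre A p" for a p
    using \<Delta> that by (simp add: bundle_morphism_def)
  then have "\<Delta> p a = gscale 0 a" if "a \<in> fibre A p" for a p
    using zero[of "\<Delta> p a" p] that by (simp add: gscale_def)
  then show ?thesis by blast
next
  case False
  then obtain w :: 'e where w: "w \<noteq> 0" by blast
  have "\<exists>\<kappa> \<mu>. \<forall>a\<in>fibre A p. \<Delta> p a = (\<lambda>f. \<kappa> * fst a f, \<lambda>w. \<mu> * snd a w)" for p
  proof -
    obtain x f where "x \<in> tangent_space A p" "smooth_fun A f" "x f = 1"
      using w by (rule tangent_nontrivial)
    then show ?thesis
      by (rule fibre_endomorphism_scalar[OF \<Delta> anomaly_equivariant[OF \<Delta> comm], rotated -3])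
  qed
  then obtain \<kappa> \<mu> where \<Delta>eq: "\<Delta> p a = (\<lambda>f. \<kappa> p * fst a f, \<lambda>w. \<mu> p * snd a w)"
    if "a \<in> fibre A p" for p a
    by metis
  have on: "on_sections \<Delta> u = (\<lambda>p. (\<lambda>f. \<kappa> p * fst (u p) f, \<lambda>w. \<mu> p * snd (u p) w))"
    if "smooth_section A u" for u
    by (simp add: on_sections_def \<Delta>eq section_fibre[OF that])
  have sec: "smooth_section A (on_sections \<Delta> u)" if "smooth_section A u" for u
    using \<Delta> that by (simp add: bundle_morphism_def on_sections_def)
  have \<kappa>X: "vector_field A (\<lambda>p f. \<kappa> p * X p f)" if "vector_field A X" for X
    using sec[OF vector_zero_section[OF that]] on[OF vector_zero_section[OF that]]
    by (simp add: smooth_section_def)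
  have "\<exists>T. open T \<and> p \<in> T \<and> (\<forall>q\<in>T. \<kappa> q = \<kappa> p)" for p
  proof -
    obtain y f where y: "y \<in> tangent_space A p" "smooth_fun A f" "y f = 1"
      using w by (rule tangent_nontrivial)
    obtain Y where Y: "vector_field A Y" "Y p = y" using y(1) by (rule tangent_extends)
    show ?thesis
    proof (rule locally_constant_factor)
      show "smooth_fun A (\<lambda>q. Y q f)" by (rule vector_field_smooth[OF Y(1)])
      show "smooth_fun A (\<lambda>q. \<kappa> q * Y q f)" by (rule vector_field_smooth[OF \<kappa>X[OF Y(1)]])
      show "Y p f \<noteq> 0" using y(3) Y(2) by simp
      fix X q assume X: "vector_field A X"
      note s = vector_zero_section[OF X] vector_zero_section[OF Y(1)]
      have "fst (courant_product A (\<lambda>p. (X p, \<lambda>w. 0)) (on_sections \<Delta> (\<lambda>p. (Y p, \<lambda>w. 0))) q) f =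
          lie_bracket X (\<lambda>p f. \<kappa> p * Y p f) q f"
        unfolding on[OF s(2)] courant_product_vector by simp
      moreover have "fst (on_sections \<Delta> (courant_product A (\<lambda>p. (X p, \<lambda>w. 0)) (\<lambda>p. (Y p, \<lambda>w. 0))) q) f =
          \<kappa> q * lie_bracket X Y q f"
        unfolding on_sections_def \<Delta>eq[OF courant_product_fibre[OF s]]
        by (simp add: courant_product_vector)
      ultimately have "lie_bracket X (\<lambda>p f. \<kappa> p * Y p f) q f = \<kappa> q * lie_bracket X Y q f"
        by (simp only: comm[OF s])
      \<comment> \<open>Both brackets contain \<kappa> times Y (X f), which cancels.\<close>
      then show "X q (\<lambda>q. \<kappa> q * Y q f) = \<kappa> q * X q (\<lambda>q. Y q f)"
        by (simp add: lie_bracket_def right_diff_distrib)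
    qed simp
  qed
  \<comment> \<open>Here connectedness turns local constancy into constancy.\<close>
  then have "\<kappa> constant_on UNIV"
    by (intro locally_constant_imp_constant[OF conn]) simp
  then obtain c where c: "\<And>p. \<kappa> p = c" by (auto simp: constant_on_def)
  have "\<mu> p = c" for p
  proof -
    obtain y f where y: "y \<in> tangent_space A p" "smooth_fun A f" "y f = 1"
      using w by (rule tangent_nontrivial)
    obtain Y where Y: "vector_field A Y" "Y p = y" using y(1) by (rule tangent_extends)
    \<comment> \<open>The form \<eta> = (f - f p) df is built to make Y (\<eta>(Y)) = 1 at p: as f -
      f p vanishes there, the Leibniz rule leaves the square of Y f, which is 1.\<close>
    define g where "g = (\<lambda>q. f q - f p)"
    define \<eta> where "\<eta> = (\<lambda>q w. g q * differential A f q w)"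
    have g: "smooth_fun A g" unfolding g_def by (intro smooth_fun_diff y(2) smooth_fun_const)
    have \<eta>: "one_form A \<eta>"
      using differential_one_form[OF y(2)] g
      by (auto simp: one_form_def \<eta>_def cotangent_space_scale intro: smooth_fun_mult)
    have \<eta>Y: "(\<lambda>q. \<eta> q (Y q)) = (\<lambda>q. g q * Y q f)"
      by (simp add: \<eta>_def differential_def vector_field_tangent[OF Y(1)])
    have "Y p g = 1"
      unfolding g_def
      by (simp add: tangent_diff[OF vector_field_tangent[OF Y(1)] y(2) smooth_fun_const]
          tangent_const[OF vector_field_tangent[OF Y(1)]]) (simp add: Y(2) y(3))
    moreover have "g p = 0" "Y p f = 1" by (simp_all add: g_def Y(2) y(3))
    ultimately have one: "Y p (\<lambda>q. \<eta> q (Y q)) = 1"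
      unfolding \<eta>Y
      by (simp add: tangent_mult[OF vector_field_tangent[OF Y(1)] g vector_field_smooth[OF Y(1)]])
    let ?v = "\<lambda>p. (Y p, \<eta> p)"
    have s: "smooth_section A ?v" using Y(1) \<eta> by (simp add: smooth_section_def)
    have on': "on_sections \<Delta> ?v = (\<lambda>p. (\<lambda>f. c * Y p f, \<lambda>w. \<mu> p * \<eta> p w))"
      by (simp add: on[OF s] c)
    \<comment> \<open>Smoothness of \<mu> is not known; \<mu> \<eta> is a one-form because it is the
      covector part of the section \<Delta> v.\<close>
    have \<mu>\<eta>: "one_form A (\<lambda>p w. \<mu> p * \<eta> p w)" and cY: "vector_field A (\<lambda>p f. c * Y p f)"
      using sec[OF s] by (simp_all add: smooth_section_def on')
    have null: "\<eta> p (\<lambda>f. 0) = 0" by (rule cotangent_null[OF one_form_cotangent[OF \<eta>]])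
    have "snd (on_sections \<Delta> (courant_product A ?v ?v) p) (Y p) =
        snd (courant_product A (on_sections \<Delta> ?v) ?v p) (Y p)"
      by (simp add: square[OF s])
    \<comment> \<open>Evaluated on Y, both exterior derivatives vanish by skew-symmetry, and the Lie
      derivatives reduce the equation to \<mu> p = c.\<close>
    then have "\<mu> p * (lie_derivative A Y \<eta> p (Y p) - ext_derivative A \<eta> p (Y p) (Y p)) =
        lie_derivative A (\<lambda>p f. c * Y p f) \<eta> p (Y p) -
        ext_derivative A (\<lambda>p w. \<mu> p * \<eta> p w) p (Y p) (Y p)"
      using \<Delta>eq[OF courant_product_fibre[OF s s], of p]
      unfolding on' by (simp add: on_sections_def courant_product_pair)
    moreover have "lie_derivative A Y \<eta> p (Y p) = 1"
      by (simp add: lie_derivative(2)[OF Y(1) \<eta> Y(1)] one lie_bracket_self null)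
    moreover have "lie_derivative A (\<lambda>p f. c * Y p f) \<eta> p (Y p) = c"
      by (simp add: lie_derivative(2)[OF cY \<eta> Y(1)] one lie_bracket_cmult_left[OF Y(1) Y(1)]
          lie_bracket_self null)
    ultimately show ?thesis
      by (simp add: two_form_diagonal[OF ext_derivative(1)[OF \<eta>]]
          two_form_diagonal[OF ext_derivative(1)[OF \<mu>\<eta>]])
  qed
  then have "\<Delta> p a = gscale c a" if "a \<in> fibre A p" for p a
    by (simp add: \<Delta>eq[OF that] c gscale_def)
  then show ?thesis by blast
qed

lemma scalar_imp_equivariant:
  assumes \<Delta>: "\<And>p a. a \<in> fibre A p \<Longrightarrow> \<Delta> p a = gscale c a"
    and u: "smooth_section A u" and v: "smooth_section A v"
  shows "courant_product A u (on_sections \<Delta> v) = on_sections \<Delta> (courant_product A u v)"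
    and "on_sections \<Delta> (courant_product A v v) = courant_product A (on_sections \<Delta> v) v"
proof -
  have "on_sections \<Delta> v = (\<lambda>p. gscale c (v p))"
    by (simp add: on_sections_def \<Delta> section_fibre[OF v])
  then show "courant_product A u (on_sections \<Delta> v) = on_sections \<Delta> (courant_product A u v)"
    and "on_sections \<Delta> (courant_product A v v) = courant_product A (on_sections \<Delta> v) v"
    by (simp_all add: courant_product_scale_right[OF u v] courant_product_self_scale_left[OF v])
       (simp_all add: on_sections_def \<Delta> courant_product_fibre u v)
qed

end

theorem theorem3:
  fixes A :: "('m::{t2_space, second_countable_topology}, 'e::real_inner) atlas"
  assumes "smooth_atlas A"
    and "connected (UNIV :: 'm set)"
  shows "irreducible_courant A (courant_product A)"
proof -
  obtain B0 :: "'e set" where "finite B0" "span B0 = UNIV"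
    using assms(1)[unfolded smooth_atlas_def, THEN conjunct1] by auto
  then obtain B :: "'e set" where "frame B" by (rule frame_exists)
  with assms(1) interpret smooth_manifold A B by unfold_locales
  show ?thesis
    unfolding irreducible_courant_def
  proof (intro allI impI iffI; elim conjE exE)
    fix \<Delta>
    assume "bundle_morphism A \<Delta>"
      "\<forall>u v. smooth_section A u \<longrightarrow> smooth_section A v \<longrightarrow>
        courant_product A u (on_sections \<Delta> v) = on_sections \<Delta> (courant_product A u v)"
      "\<forall>v. smooth_section A v \<longrightarrow>
        on_sections \<Delta> (courant_product A v v) = courant_product A (on_sections \<Delta> v) v"
    then show "\<exists>c. \<forall>p. \<forall>a\<in>fibre A p. \<Delta> p a = gscale c a"
      by (intro equivariant_imp_scalar[OF assms(2)]) auto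
  next
    fix \<Delta> c
    assume "\<forall>p. \<forall>a\<in>fibre A p. \<Delta> p a = gscale c a"
    then show "(\<forall>u v. smooth_section A u \<longrightarrow> smooth_section A v \<longrightarrow>
        courant_product A u (on_sections \<Delta> v) = on_sections \<Delta> (courant_product A u v)) \<and>
      (\<forall>v. smooth_section A v \<longrightarrow>
        on_sections \<Delta> (courant_product A v v) = courant_product A (on_sections \<Delta> v) v)"
      using scalar_imp_equivariant[of \<Delta> c] by simp
  qed
qed

end
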